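(* Let $T$ be an upper probability polynomial functor and $(X,\alpha)$ a $T$-coalgebra. Then the family of relations $\{\models^\alpha_S\}_{S\in\mathsf{Ing}\,T}$ satisfies every inference rule in the definition of a $T$-deduction system: Assumption, Modus ponens, Cut, Deduction, Necessitation, Constant, Definite box, Archimedean and both Cover rules hold when $\vdash_S$ is replaced by $\models^\alpha_S$.
   Context: An uncertainty space is $(X,\Sigma)$ with $\Sigma$ an algebra of subsets of $X$ (nonempty, closed under finite unions and complements $U^c=X\setminus U$); measurable maps pull measurable sets back. A probability measure is a finitely additive $\mu:\Sigma\to[0,1]$ with $\mu(\emptyset)=0,\mu(X)=1$. An upper probability measure is $g:\Sigma\to[0,1]$ with $g(U)=\sup_{\mu\in\mathcal P}\mu(U)$ for a nonempty set $\mathcal P$ of probability measures (equivalently, by Anger–Lembcke: $g(\emptyset)=0$, $g(X)=1$, and $k+n\,g(U)\le\sum_{i=1}^mg(U_i)$ whenever every point of $X$ is in at least $k$ of the $U_i$ and every point of $U$ in at least $n+k$ of them). $\underline g(U)=1-g(U^c)$. $\Delta^*X$: set of upper probability measures with the algebra generated by $\beta^{p,q}(U)=\{g:g(U)\ge p,\ 1-g(U^c)\ge q\}$; $(\Delta^*f)(g)(U)=g(f^{-1}(U))$. Products carry the algebra generated by measurable rectangles (projections $\pi_j$), coproducts (injections $in_j$) the algebra generated by the $in_j(U_j)$; constant functors send everything to a fixed $(M,\Sigma_M)$. Upper probability polynomial functors: smallest class of endofunctors of uncertainty spaces containing $Id$ and constants, closed under pointwise $\times$, $+$, composition with $\Delta^*$.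 A $T$-coalgebra is $(X,\alpha)$, $\alpha:X\to TX$ measurable. $\mathsf{Ing}\,T$: $\mathsf{Ing}\,Id=\{Id\}$, $\mathsf{Ing}\,M=\{M,Id\}$, $\mathsf{Ing}(T_1\times T_2)=\{T_1\times T_2\}\cup\mathsf{Ing}\,T_1\cup\mathsf{Ing}\,T_2$, same for $+$, $\mathsf{Ing}\,\Delta^*S=\{\Delta^*S\}\cup\mathsf{Ing}\,S$. Formulas of sort $S$ ($\mathsf{Form}_S$): $\bot_S$; $\varphi\to\psi$; $A:M$ for $A\in\Sigma_M$ or $A=\{m\}$; $[\mathsf{pr}_j]\varphi:S_1\times S_2$ ($\varphi:S_j$); $[\mathsf{in}_j]\varphi:S_1+S_2$ ($\varphi:S_j$); $[\mathsf{next}]\varphi:Id$ ($\varphi:T$); $[(p,q)]\varphi:\Delta^*S$ for $\varphi::S$ (all constant subformulas measurable). Non-probabilistic labels $\kappa\in\{\mathsf{pr}_j,\mathsf{in}_j,\mathsf{next}\}$ go from $S_1\times S_2$, $S_1+S_2$, $Id$ to $S_j$, $S_j$, $T$; $[\kappa]\Gamma=\{[\kappa]\psi:\psi\in\Gamma\}$. Abbreviations: $\neg,\vee,\wedge,\leftrightarrow,\top_S$; $\mathsf U_{\ge p}\varphi=[(p,0)]\varphi$, $\mathsf L_{\ge p}\varphi=[(0,p)]\varphi$, $\mathsf U_{\le p}\varphi=[(0,1-p)]\neg\varphi$, $\mathsf U_{<p}=\neg\mathsf U_{\ge p}$. Semantics: $[\![\bot]\!]=\emptyset$, $[\![A]\!]=A$,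 $[\![\varphi\to\psi]\!]=(SX\setminus[\![\varphi]\!])\cup[\![\psi]\!]$, $[\![[\mathsf{pr}_j]\varphi]\!]=\pi_j^{-1}[\![\varphi]\!]$, $[\![[\mathsf{in}_1]\varphi]\!]=in_1[\![\varphi]\!]\cup in_2(S_2X)$ (symmetric), $[\![[\mathsf{next}]\varphi]\!]=\alpha^{-1}[\![\varphi]\!]_T$, $[\![[(p,q)]\varphi]\!]=\beta^{p,q}[\![\varphi]\!]$. $\Gamma\models^\alpha_S\varphi$ iff every $x\in SX$ belonging to $[\![\psi]\!]$ for all $\psi\in\Gamma$ belongs to $[\![\varphi]\!]$; $\models^\alpha_S\varphi$ means $\emptyset\models^\alpha_S\varphi$. Axioms $Ax_S$: Boolean tautologies; for constant $M$: $\{c\}\to A$ if $c\in A$, $\{c\}\to\neg A$ if $c\notin A$; $\neg[\kappa]\varphi\to[\kappa]\neg\varphi$; $\neg[\mathsf{pr}_j]\bot_{S_j}$; $\neg[\mathsf{in}_1]\bot_{S_1}\leftrightarrow[\mathsf{in}_2]\bot_{S_2}$; $\neg[\mathsf{next}]\bot_T$; for $\Delta^*S'$, $\varphi,\psi::S'$: $\mathsf U_{\le p}\varphi\to\mathsf U_{<q}\varphi$ ($p<q$), $\mathsf U_{<p}\varphi\to\mathsf U_{\le p}\varphi$, $\mathsf L_{\ge1}(\varphi\to\psi)\to(\mathsf U_{\ge p}\varphi\to\mathsf U_{\ge p}\psi)$, $[(p,q)]\varphi\leftrightarrow(\mathsf U_{\ge p}\varphi\wedge\mathsf L_{\ge q}\varphi)$.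 The rules, for a family of relations $\vdash_S\subseteq\mathcal P(\mathsf{Form}_S)\times\mathsf{Form}_S$ ($\Gamma\vdash_S\Lambda$ meaning $\Gamma\vdash_S\psi$ for all $\psi\in\Lambda$, $\vdash_S\varphi$ meaning $\emptyset\vdash_S\varphi$): Assumption: $\varphi\in\Gamma\cup Ax_S\Rightarrow\Gamma\vdash_S\varphi$. Modus ponens: $\{\varphi,\varphi\to\psi\}\vdash_S\psi$. Cut: $\Gamma\vdash_S\Lambda$ and $\Lambda\vdash_S\varphi$ imply $\Gamma\vdash_S\varphi$. Deduction: $\Gamma\cup\{\varphi\}\vdash_S\psi\Rightarrow\Gamma\vdash_S\varphi\to\psi$. Necessitation: $\varphi::S$, $\vdash_S\varphi\Rightarrow\vdash_{\Delta^*S}\mathsf L_{\ge1}\varphi$. Constant: $\{\neg\{c\}:c\in M\}\vdash_M\bot_M$. Definite box: $\Gamma\vdash_{S'}\psi\Rightarrow[\kappa]\Gamma\vdash_S[\kappa]\psi$ for $\kappa$ from $S$ to $S'$. Archimedean: $\{\mathsf U_{\ge q}\psi:q<p\}\vdash_{\Delta^*S}\mathsf U_{\ge p}\psi$ and $\{\mathsf L_{\ge q}\psi:q<p\}\vdash_{\Delta^*S}\mathsf L_{\ge p}\psi$. Cover rules, for $\varphi,\varphi_i::S$, $k\ge0$, $J_m=\{1,\dots,m\}$: (C1) if $n\ge1$, $\vdash_S\varphi\to\bigvee_{I\subseteq J_m,|I|=n+k}\bigwedge_{i\in I}\varphi_i$, $\vdash_S\bigvee_{I\subseteq J_m,|I|=k}\bigwedge_{i\in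 I}\varphi_i$, $p_i\in[0,1]$, $p=\max(0,\min(1,(\sum p_i-k)/n))$, then $\vdash_{\Delta^*S}(\bigwedge_i\mathsf U_{\le p_i}\varphi_i)\to\mathsf U_{\le p}\varphi$; (C2) if $\vdash_S\bigvee_{I\subseteq J_m,|I|=k}\bigwedge_{i\in I}\varphi_i$ and $p_i\in[0,1]$ with $\sum p_i<k$, then $\vdash_{\Delta^*S}\neg\bigwedge_i\mathsf U_{\le p_i}\varphi_i$. *)

theory Defs
  imports "HOL-Analysis.Analysis"
begin

section \<open>Uncertainty spaces and upper probability measures\<close>

type_synonym 'a uspace = "'a set \<times> 'a set set"

abbreviation pts :: "'a uspace \<Rightarrow> 'a set" where "pts \<equiv> fst"
abbreviation alg :: "'a uspace \<Rightarrow> 'a set set" where "alg \<equiv> snd"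

definition uncertainty_space :: "'a uspace \<Rightarrow> bool" where
  "uncertainty_space A \<longleftrightarrow> algebra (pts A) (alg A)"

definition measurable_map :: "'a uspace \<Rightarrow> 'b uspace \<Rightarrow> ('a \<Rightarrow> 'b) \<Rightarrow> bool" where
  "measurable_map A B f \<longleftrightarrow>
     f \<in> pts A \<rightarrow> pts B \<and> (\<forall>U\<in>alg B. f -` U \<inter> pts A \<in> alg A)"

definition fin_prob :: "'a uspace \<Rightarrow> ('a set \<Rightarrow> real) \<Rightarrow> bool" where
  "fin_prob A \<mu> \<longleftrightarrow>
     (\<forall>U\<in>alg A. \<mu> U \<in> {0..1}) \<and> \<mu> {} = 0 \<and> \<mu> (pts A) = 1 \<and> additive (alg A) \<mu>"

definition upper_prob :: "'a uspace \<Rightarrow> ('a set \<Rightarrow> real) \<Rightarrow> bool" where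
  "upper_prob A g \<longleftrightarrow>
     (\<exists>P. P \<noteq> {} \<and> (\<forall>\<mu>\<in>P. fin_prob A \<mu>) \<and> (\<forall>U\<in>alg A. g U = (SUP \<mu>\<in>P. \<mu> U)))"

text \<open>Functions on the algebra of \<open>A\<close> are represented by the members of
  \<^term>\<open>extensional (alg A)\<close>, so that equality of points is equality of functions on the algebra.\<close>

definition upper_probs :: "'a uspace \<Rightarrow> ('a set \<Rightarrow> real) set" where
  "upper_probs A = {g \<in> extensional (alg A). upper_prob A g}"

definition beta :: "'a uspace \<Rightarrow> real \<Rightarrow> real \<Rightarrow> 'a set \<Rightarrow> ('a set \<Rightarrow> real) set" where
  "beta A p q U = {g \<in> upper_probs A. g U \<ge> p \<and> 1 - g (pts A - U) \<ge> q}"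

definition upper_space :: "'a uspace \<Rightarrow> ('a set \<Rightarrow> real) uspace" where
  "upper_space A =
     (upper_probs A,
      algebra (upper_probs A) hull {beta A p q U | p q U. p \<in> {0..1} \<and> q \<in> {0..1} \<and> U \<in> alg A})"

definition prod_space :: "'a uspace \<Rightarrow> 'b uspace \<Rightarrow> ('a \<times> 'b) uspace" where
  "prod_space A B =
     (pts A \<times> pts B, algebra (pts A \<times> pts B) hull {U \<times> V | U V. U \<in> alg A \<and> V \<in> alg B})"

definition sum_space :: "'a uspace \<Rightarrow> 'b uspace \<Rightarrow> ('a + 'b) uspace" where
  "sum_space A B =
     (pts A <+> pts B,
      algebra (pts A <+> pts B) hull ({Inl ` U | U. U \<in> alg A} \<union> {Inr ` V | V. V \<in> alg B}))"

definition image_space :: "('a \<Rightarrow> 'b) \<Rightarrow> 'a uspace \<Rightarrow> 'b uspace" where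
  "image_space e A = (e ` pts A, (\<lambda>U. e ` U) ` alg A)"


section \<open>Upper probability polynomial functors\<close>

text \<open>A functor is given by the expression that builds it; \<open>FDelta S\<close> is the composite of
  \<open>\<Delta>\<^sup>*\<close> after \<open>S\<close>.  All constant spaces of an expression live on subsets of one type \<open>'m\<close>.\<close>

datatype 'm func =
    FId
  | FConst "'m uspace"
  | FProd "'m func" "'m func"
  | FSum "'m func" "'m func"
  | FDelta "'m func"

primrec poly_functor :: "'m func \<Rightarrow> bool" where
  "poly_functor FId \<longleftrightarrow> True"
| "poly_functor (FConst M) \<longleftrightarrow> uncertainty_space M"
| "poly_functor (FProd S1 S2) \<longleftrightarrow> poly_functor S1 \<and> poly_functor S2"
| "poly_functor (FSum S1 S2) \<longleftrightarrow> poly_functor S1 \<and> poly_functor S2"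
| "poly_functor (FDelta S) \<longleftrightarrow> poly_functor S"

primrec Ing :: "'m func \<Rightarrow> 'm func set" where
  "Ing FId = {FId}"
| "Ing (FConst M) = {FConst M, FId}"
| "Ing (FProd S1 S2) = {FProd S1 S2} \<union> Ing S1 \<union> Ing S2"
| "Ing (FSum S1 S2) = {FSum S1 S2} \<union> Ing S1 \<union> Ing S2"
| "Ing (FDelta S) = {FDelta S} \<union> Ing S"

text \<open>The spaces \<open>S X\<close>, for all \<open>S\<close>, have to live in a single type \<open>pt\<close>.  Upper probability
  measures on a space \<open>A\<close> over \<open>pt\<close> have type \<^typ>\<open>'a set \<Rightarrow> real\<close> with \<open>'a\<close> instantiated to
  \<open>pt\<close>, which cannot occur as a constructor argument of \<open>pt\<close> itself.  But the algebras of all the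
  spaces \<open>S X\<close> are so small that each is covered by a map from the fixed type \<open>code\<close> below
  (lemma \<open>alg_functor_space_subset_range_codebook\<close>); an upper probability measure is therefore
  stored as its composite with a chosen such map.  Lemma \<open>inj_on_encode\<close> shows that this is a
  faithful copy: every \<open>functor_space X (FDelta S)\<close> is an isomorphic copy, via \<open>encode\<close>, of the
  \<open>upper_space\<close> of \<open>functor_space X S\<close>.\<close>

datatype ('x, 'm) code =
    CBase "'x set"
  | CConst "'m set"
  | CGen real real "('x, 'm) code" "('x, 'm) code"
  | CNeg "('x, 'm) code"
  | CUn "('x, 'm) code" "('x, 'm) code"

datatype ('x, 'm) pt =
    PBase 'x
  | PConst 'm
  | PPair "('x, 'm) pt" "('x, 'm) pt"
  | PIn1 "('x, 'm) pt"
  | PIn2 "('x, 'm) pt"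
  | PUpper "('x, 'm) code \<Rightarrow> real"

definition codebook :: "('x, 'm) pt uspace \<Rightarrow> ('x, 'm) code \<Rightarrow> ('x, 'm) pt set" where
  "codebook A = (SOME d. alg A \<subseteq> range d)"

definition encode :: "('x, 'm) pt uspace \<Rightarrow> (('x, 'm) pt set \<Rightarrow> real) \<Rightarrow> ('x, 'm) pt" where
  "encode A g = PUpper (\<lambda>c. g (codebook A c))"

primrec functor_space :: "'x uspace \<Rightarrow> 'm func \<Rightarrow> ('x, 'm) pt uspace" where
  "functor_space X FId = image_space PBase X"
| "functor_space X (FConst M) = image_space PConst M"
| "functor_space X (FProd S1 S2) =
     image_space (case_prod PPair) (prod_space (functor_space X S1) (functor_space X S2))"
| "functor_space X (FSum S1 S2) =
     image_space (case_sum PIn1 PIn2) (sum_space (functor_space X S1) (functor_space X S2))"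
| "functor_space X (FDelta S) =
     image_space (encode (functor_space X S)) (upper_space (functor_space X S))"

definition coalgebra :: "'m func \<Rightarrow> 'x uspace \<Rightarrow> ('x \<Rightarrow> ('x, 'm) pt) \<Rightarrow> bool" where
  "coalgebra T X \<alpha> \<longleftrightarrow> uncertainty_space X \<and> measurable_map X (functor_space X T) \<alpha>"


subsection \<open>The encoding is faithful\<close>

lemma algebra_hull:
  assumes "G \<subseteq> Pow \<Omega>"
  shows "algebra \<Omega> (algebra \<Omega> hull G)"
proof -
  have "algebra \<Omega> (Pow \<Omega>)" by (auto simp: algebra_iff_Un)
  with assms have "algebra \<Omega> hull G \<subseteq> Pow \<Omega>" unfolding hull_def by blast
  moreover have "{} \<in> algebra \<Omega> hull G"
    unfolding hull_def by (simp add: algebra_iff_Un)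
  moreover have "\<Omega> - U \<in> algebra \<Omega> hull G" if "U \<in> algebra \<Omega> hull G" for U
    using that unfolding hull_def by (simp add: algebra_iff_Un)
  moreover have "U \<union> V \<in> algebra \<Omega> hull G"
    if "U \<in> algebra \<Omega> hull G" "V \<in> algebra \<Omega> hull G" for U V
    using that unfolding hull_def by (simp add: algebra_iff_Un)
  ultimately show ?thesis unfolding algebra_iff_Un by blast
qed

lemma uncertainty_space_image_space:
  assumes "uncertainty_space A" "inj_on e (pts A)"
  shows "uncertainty_space (image_space e A)"
proof -
  have a: "alg A \<subseteq> Pow (pts A)" "{} \<in> alg A"
    "\<And>U. U \<in> alg A \<Longrightarrow> pts A - U \<in> alg A" "\<And>U V. U \<in> alg A \<Longrightarrow> V \<in> alg A \<Longrightarrow> U \<union> V \<in> alg A"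
    using assms(1) unfolding uncertainty_space_def algebra_iff_Un by auto
  let ?B = "(\<lambda>U. e ` U) ` alg A"
  have 1: "?B \<subseteq> Pow (e ` pts A)" using a(1) by blast
  have 2: "{} \<in> ?B" using a(2) by blast
  have 3: "e ` pts A - W \<in> ?B" if W: "W \<in> ?B" for W
  proof -
    obtain U where U: "U \<in> alg A" "W = e ` U" using W by blast
    then have "e ` pts A - W = e ` (pts A - U)"
      using a(1) assms(2) inj_on_image_set_diff[of e "pts A" "pts A" U] by auto
    then show ?thesis using a(3)[OF U(1)] by blast
  qed
  have 4: "V \<union> W \<in> ?B" if VW: "V \<in> ?B" "W \<in> ?B" for V W
  proof -
    obtain U U' where "U \<in> alg A" "V = e ` U" "U' \<in> alg A" "W = e ` U'" using VW by blast
    then show ?thesis using a(4) by (metis image_Un imageI)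
  qed
  show ?thesis
    unfolding uncertainty_space_def algebra_iff_Un image_space_def fst_conv snd_conv
    by (intro conjI ballI 1 2 3 4)
qed

lemma uncertainty_space_upper_space: "uncertainty_space (upper_space A)"
  unfolding uncertainty_space_def upper_space_def by (auto intro!: algebra_hull simp: beta_def)

lemma uncertainty_space_prod_space:
  assumes "uncertainty_space A" "uncertainty_space B"
  shows "uncertainty_space (prod_space A B)"
proof -
  have "alg A \<subseteq> Pow (pts A)" "alg B \<subseteq> Pow (pts B)"
    using assms unfolding uncertainty_space_def algebra_iff_Un by auto
  then show ?thesis
    unfolding uncertainty_space_def prod_space_def by (auto intro!: algebra_hull)
qed

lemma uncertainty_space_sum_space:
  assumes "uncertainty_space A" "uncertainty_space B"
  shows "uncertainty_space (sum_space A B)"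
proof -
  have "alg A \<subseteq> Pow (pts A)" "alg B \<subseteq> Pow (pts B)"
    using assms unfolding uncertainty_space_def algebra_iff_Un by auto
  then show ?thesis
    unfolding uncertainty_space_def sum_space_def by (auto intro!: algebra_hull)
qed

primrec decode ::
    "(real \<Rightarrow> real \<Rightarrow> ('x, 'm) code \<Rightarrow> ('x, 'm) code \<Rightarrow> 'a set) \<Rightarrow> 'a set \<Rightarrow> ('x, 'm) code \<Rightarrow> 'a set"
  where
  "decode f \<Omega> (CBase B) = {}"
| "decode f \<Omega> (CConst B) = {}"
| "decode f \<Omega> (CGen p q c c') = f p q c c'"
| "decode f \<Omega> (CNeg c) = \<Omega> - decode f \<Omega> c"
| "decode f \<Omega> (CUn c c') = decode f \<Omega> c \<union> decode f \<Omega> c'"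

lemma hull_subset_range_decode:
  fixes f :: "real \<Rightarrow> real \<Rightarrow> ('x, 'm) code \<Rightarrow> ('x, 'm) code \<Rightarrow> 'a set"
  assumes "G \<subseteq> Pow \<Omega>" "\<And>U. U \<in> G \<Longrightarrow> \<exists>p q c c'. U = f p q c c'"
  shows "algebra \<Omega> hull G \<subseteq> range (decode f \<Omega>)"
proof -
  let ?R = "Pow \<Omega> \<inter> range (decode f \<Omega>)"
  have 1: "{} \<in> range (decode f \<Omega>)"
    by (rule range_eqI[of _ _ "CBase {}"]) simp
  have 2: "\<Omega> - U \<in> range (decode f \<Omega>)" if U: "U \<in> range (decode f \<Omega>)" for U
  proof -
    obtain c where "U = decode f \<Omega> c" using U by blast
    then show ?thesis by (intro range_eqI[of _ _ "CNeg c"]) simp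
  qed
  have 3: "U \<union> V \<in> range (decode f \<Omega>)"
    if UV: "U \<in> range (decode f \<Omega>)" "V \<in> range (decode f \<Omega>)" for U V
  proof -
    obtain c c' where "U = decode f \<Omega> c" "V = decode f \<Omega> c'" using UV by blast
    then show ?thesis by (intro range_eqI[of _ _ "CUn c c'"]) simp
  qed
  have "algebra \<Omega> ?R" unfolding algebra_iff_Un using 1 2 3 by auto
  moreover have "U \<in> ?R" if U: "U \<in> G" for U
  proof -
    obtain p q c c' where "U = f p q c c'" using assms(2)[OF U] by blast
    then have "U \<in> range (decode f \<Omega>)" by (intro range_eqI[of _ _ "CGen p q c c'"]) simp
    then show ?thesis using assms(1) U by blast
  qed
  ultimately have "algebra \<Omega> hull G \<subseteq> ?R" unfolding hull_def by (intro Inter_lower) blast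
  then show ?thesis by blast
qed

lemma image_space_codes:
  assumes "alg A \<subseteq> range (d :: ('x, 'm) code \<Rightarrow> 'a set)"
  shows "\<exists>d' :: ('x, 'm) code \<Rightarrow> 'b set. alg (image_space e A) \<subseteq> range d'"
proof
  show "alg (image_space e A) \<subseteq> range (\<lambda>c. e ` d c)"
    using assms unfolding image_space_def by fastforce
qed

lemma encode_inj:
  fixes A :: "('x, 'm) pt uspace"
  assumes "alg A \<subseteq> range (codebook A)"
  shows "inj_on (encode A) (upper_probs A)"
proof (rule inj_onI)
  fix g h assume "g \<in> upper_probs A" "h \<in> upper_probs A" and eq: "encode A g = encode A h"
  then have e: "g \<in> extensional (alg A)" "h \<in> extensional (alg A)" by (auto simp: upper_probs_def)
  have "g (codebook A c) = h (codebook A c)" for c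
    using eq by (simp add: encode_def fun_eq_iff)
  then have "g U = h U" if "U \<in> alg A" for U using that assms by (metis imageE subsetD)
  then show "g = h" using e by (meson extensionalityI)
qed

lemma codebook_range:
  fixes A :: "('x, 'm) pt uspace"
  assumes "\<exists>d :: ('x, 'm) code \<Rightarrow> _. alg A \<subseteq> range d"
  shows "alg A \<subseteq> range (codebook A)"
  unfolding codebook_def using someI_ex[OF assms] .

lemma functor_space_aux:
  fixes X :: "'x uspace" and S :: "'m func"
  assumes "uncertainty_space X" "poly_functor S"
  shows "uncertainty_space (functor_space X S) \<and>
         (\<exists>d :: ('x, 'm) code \<Rightarrow> _. alg (functor_space X S) \<subseteq> range d)"
  using assms(2)
proof (induction S)
  case FId
  have "alg (functor_space X FId :: ('x, 'm) pt uspace) \<subseteq>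
      range (\<lambda>c :: ('x, 'm) code. case c of CBase U \<Rightarrow> PBase ` U | _ \<Rightarrow> {})"
  proof
    fix V :: "('x, 'm) pt set" assume "V \<in> alg (functor_space X FId)"
    then obtain U where "V = PBase ` U" by (auto simp: image_space_def)
    then show "V \<in> range (\<lambda>c :: ('x, 'm) code. case c of CBase U \<Rightarrow> PBase ` U | _ \<Rightarrow> {})"
      by (intro range_eqI[of _ _ "CBase U"]) simp
  qed
  then show ?case
    using assms(1) by (auto intro!: uncertainty_space_image_space inj_onI simp del: split_paired_Ex)
next
  case (FConst M)
  have "alg (functor_space X (FConst M)) \<subseteq>
      range (\<lambda>c :: ('x, 'm) code. case c of CConst U \<Rightarrow> PConst ` U | _ \<Rightarrow> {})"
  proof
    fix V :: "('x, 'm) pt set" assume "V \<in> alg (functor_space X (FConst M))"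
    then obtain U where "V = PConst ` U" by (auto simp: image_space_def)
    then show "V \<in> range (\<lambda>c :: ('x, 'm) code. case c of CConst U \<Rightarrow> PConst ` U | _ \<Rightarrow> {})"
      by (intro range_eqI[of _ _ "CConst U"]) simp
  qed
  then show ?case
    using FConst by (auto intro!: uncertainty_space_image_space inj_onI)
next
  case (FProd S1 S2)
  let ?A = "functor_space X S1" and ?B = "functor_space X S2"
  obtain d1 d2 :: "('x, 'm) code \<Rightarrow> ('x, 'm) pt set"
    where d: "alg ?A \<subseteq> range d1" "alg ?B \<subseteq> range d2"
    using FProd by auto
  have u: "uncertainty_space ?A" "uncertainty_space ?B" using FProd by auto
  then have s: "alg ?A \<subseteq> Pow (pts ?A)" "alg ?B \<subseteq> Pow (pts ?B)"
    unfolding uncertainty_space_def algebra_iff_Un by auto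
  have "alg (prod_space ?A ?B) \<subseteq> range (decode (\<lambda>p q c c'. d1 c \<times> d2 c') (pts ?A \<times> pts ?B))"
    unfolding prod_space_def snd_conv
  proof (rule hull_subset_range_decode)
    fix W assume "W \<in> {U \<times> V |U V. U \<in> alg ?A \<and> V \<in> alg ?B}"
    then show "\<exists>(p::real) (q::real) c c'. W = d1 c \<times> d2 c'" using d by blast
  qed (use s in auto)
  then have "\<exists>d :: ('x, 'm) code \<Rightarrow> _. alg (functor_space X (FProd S1 S2)) \<subseteq> range d"
    unfolding functor_space.simps by (rule image_space_codes)
  moreover have "uncertainty_space (functor_space X (FProd S1 S2))"
    unfolding functor_space.simps
    by (intro uncertainty_space_image_space uncertainty_space_prod_space u) (auto intro!: inj_onI)
  ultimately show ?case by blast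
next
  case (FSum S1 S2)
  let ?A = "functor_space X S1" and ?B = "functor_space X S2"
  obtain d1 d2 :: "('x, 'm) code \<Rightarrow> ('x, 'm) pt set"
    where d: "alg ?A \<subseteq> range d1" "alg ?B \<subseteq> range d2"
    using FSum by auto
  have u: "uncertainty_space ?A" "uncertainty_space ?B" using FSum by auto
  then have s: "alg ?A \<subseteq> Pow (pts ?A)" "alg ?B \<subseteq> Pow (pts ?B)"
    unfolding uncertainty_space_def algebra_iff_Un by auto
  have "alg (sum_space ?A ?B) \<subseteq>
      range (decode (\<lambda>p q c c'. if p = 0 then Inl ` d1 c else Inr ` d2 c) (pts ?A <+> pts ?B))"
    unfolding sum_space_def snd_conv
  proof (rule hull_subset_range_decode)
    fix W assume "W \<in> {Inl ` U | U. U \<in> alg ?A} \<union> {Inr ` V | V. V \<in> alg ?B}"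
    then consider U where "U \<in> alg ?A" "W = Inl ` U" | V where "V \<in> alg ?B" "W = Inr ` V"
      by blast
    then show "\<exists>(p::real) (q::real) c (c' :: ('x, 'm) code).
        W = (if p = 0 then Inl ` d1 c else Inr ` d2 c)"
    proof cases
      case (1 U)
      obtain c where "U = d1 c" using d(1) 1(1) by blast
      then show ?thesis using 1(2) by (intro exI[of _ 0] exI[of _ c]) simp
    next
      case (2 V)
      obtain c where "V = d2 c" using d(2) 2(1) by blast
      then show ?thesis using 2(2) by (intro exI[of _ 1] exI[of _ c]) simp
    qed
  qed (use s in auto)
  then have "\<exists>d :: ('x, 'm) code \<Rightarrow> _. alg (functor_space X (FSum S1 S2)) \<subseteq> range d"
    unfolding functor_space.simps by (rule image_space_codes)
  moreover have "uncertainty_space (functor_space X (FSum S1 S2))"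
    unfolding functor_space.simps
    by (intro uncertainty_space_image_space uncertainty_space_sum_space u)
      (auto intro!: inj_onI simp: sum_space_def)
  ultimately show ?case by blast
next
  case (FDelta S)
  let ?A = "functor_space X S"
  obtain d :: "('x, 'm) code \<Rightarrow> ('x, 'm) pt set" where d: "alg ?A \<subseteq> range d"
    using FDelta by auto
  have "alg (upper_space ?A) \<subseteq> range (decode (\<lambda>p q c c'. beta ?A p q (d c)) (upper_probs ?A))"
    unfolding upper_space_def snd_conv
  proof (rule hull_subset_range_decode)
    fix W assume "W \<in> {beta ?A p q U | p q U. p \<in> {0..1} \<and> q \<in> {0..1} \<and> U \<in> alg ?A}"
    then show "\<exists>p q c (c' :: ('x, 'm) code). W = beta ?A p q (d c)" using d by blast
  qed (auto simp: beta_def)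
  then have "\<exists>d :: ('x, 'm) code \<Rightarrow> _. alg (functor_space X (FDelta S)) \<subseteq> range d"
    unfolding functor_space.simps by (rule image_space_codes)
  moreover have "inj_on (encode ?A) (upper_probs ?A)"
    using d by (intro encode_inj codebook_range) blast
  then have "uncertainty_space (functor_space X (FDelta S))"
    unfolding functor_space.simps
    by (intro uncertainty_space_image_space uncertainty_space_upper_space)
      (simp add: upper_space_def)
  ultimately show ?case by blast
qed

lemma uncertainty_space_functor_space:
  assumes "uncertainty_space X" "poly_functor S"
  shows "uncertainty_space (functor_space X S)"
  using functor_space_aux[OF assms] by blast

lemma alg_functor_space_subset_range_codebook:
  assumes "uncertainty_space X" "poly_functor S"
  shows "alg (functor_space X S) \<subseteq> range (codebook (functor_space X S))"
  using functor_space_aux[OF assms] by (intro codebook_range) blast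

lemma inj_on_encode:
  assumes "uncertainty_space X" "poly_functor S"
  shows "inj_on (encode (functor_space X S)) (pts (upper_space (functor_space X S)))"
  using encode_inj[OF alg_functor_space_subset_range_codebook[OF assms]]
  by (simp add: upper_space_def)


section \<open>Formulas and their sorts\<close>

datatype label = Pr1 | Pr2 | In1 | In2 | Next

inductive label_from_to :: "'m func \<Rightarrow> label \<Rightarrow> 'm func \<Rightarrow> 'm func \<Rightarrow> bool" for T where
  "label_from_to T Pr1 (FProd S1 S2) S1"
| "label_from_to T Pr2 (FProd S1 S2) S2"
| "label_from_to T In1 (FSum S1 S2) S1"
| "label_from_to T In2 (FSum S1 S2) S2"
| "label_from_to T Next FId T"

text \<open>Formulas carry no sort annotation, so the same expression (for instance \<open>Bot\<close>) can be a
  formula of several sorts.  Everything below takes the sort as an explicit argument.\<close>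

datatype 'm form =
    Bot
  | Imp "'m form" "'m form"  (infixr \<open>\<^bold>\<rightarrow>\<close> 55)
  | Cst "'m set"
  | Box label "'m form"
  | Prob real real "'m form"

text \<open>\<open>meas_consts T \<phi> S\<close>: all constant subformulas of \<open>\<phi>\<close>, read as a formula of sort \<open>S\<close>, are
  measurable.\<close>

primrec meas_consts :: "'m func \<Rightarrow> 'm form \<Rightarrow> 'm func \<Rightarrow> bool" where
  "meas_consts T Bot S \<longleftrightarrow> True"
| "meas_consts T (\<phi> \<^bold>\<rightarrow> \<psi>) S \<longleftrightarrow> meas_consts T \<phi> S \<and> meas_consts T \<psi> S"
| "meas_consts T (Cst A) S \<longleftrightarrow> (\<exists>M. S = FConst M \<and> A \<in> alg M)"
| "meas_consts T (Box \<kappa> \<phi>) S \<longleftrightarrow> (\<exists>S'. label_from_to T \<kappa> S S' \<and> meas_consts T \<phi> S')"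
| "meas_consts T (Prob p q \<phi>) S \<longleftrightarrow> (\<exists>S'. S = FDelta S' \<and> meas_consts T \<phi> S')"

primrec has_sort :: "'m func \<Rightarrow> 'm form \<Rightarrow> 'm func \<Rightarrow> bool" where
  "has_sort T Bot S \<longleftrightarrow> True"
| "has_sort T (\<phi> \<^bold>\<rightarrow> \<psi>) S \<longleftrightarrow> has_sort T \<phi> S \<and> has_sort T \<psi> S"
| "has_sort T (Cst A) S \<longleftrightarrow> (\<exists>M. S = FConst M \<and> (A \<in> alg M \<or> (\<exists>c\<in>pts M. A = {c})))"
| "has_sort T (Box \<kappa> \<phi>) S \<longleftrightarrow> (\<exists>S'. label_from_to T \<kappa> S S' \<and> has_sort T \<phi> S')"
| "has_sort T (Prob p q \<phi>) S \<longleftrightarrow>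
     p \<in> {0..1} \<and> q \<in> {0..1} \<and> (\<exists>S'. S = FDelta S' \<and> has_sort T \<phi> S' \<and> meas_consts T \<phi> S')"

definition Form :: "'m func \<Rightarrow> 'm func \<Rightarrow> 'm form set" where
  "Form T S = {\<phi>. has_sort T \<phi> S}"

definition MForm :: "'m func \<Rightarrow> 'm func \<Rightarrow> 'm form set" where
  "MForm T S = {\<phi> \<in> Form T S. meas_consts T \<phi> S}"

definition Neg :: "'m form \<Rightarrow> 'm form"  (\<open>\<^bold>\<not> _\<close> [60] 60) where
  "\<^bold>\<not> \<phi> = (\<phi> \<^bold>\<rightarrow> Bot)"
definition Top :: "'m form" where
  "Top = (\<^bold>\<not> Bot)"
definition Or :: "'m form \<Rightarrow> 'm form \<Rightarrow> 'm form"  (infixr \<open>\<^bold>\<or>\<close> 56) where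
  "(\<phi> \<^bold>\<or> \<psi>) = ((\<^bold>\<not> \<phi>) \<^bold>\<rightarrow> \<psi>)"
definition And :: "'m form \<Rightarrow> 'm form \<Rightarrow> 'm form"  (infixr \<open>\<^bold>\<and>\<close> 57) where
  "(\<phi> \<^bold>\<and> \<psi>) = (\<^bold>\<not> (\<phi> \<^bold>\<rightarrow> (\<^bold>\<not> \<psi>)))"
definition Iff :: "'m form \<Rightarrow> 'm form \<Rightarrow> 'm form"  (infix \<open>\<^bold>\<leftrightarrow>\<close> 54) where
  "(\<phi> \<^bold>\<leftrightarrow> \<psi>) = ((\<phi> \<^bold>\<rightarrow> \<psi>) \<^bold>\<and> (\<psi> \<^bold>\<rightarrow> \<phi>))"

fun Conj :: "'m form list \<Rightarrow> 'm form" where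
  "Conj [] = Top"
| "Conj [\<phi>] = \<phi>"
| "Conj (\<phi> # \<psi> # \<phi>s) = (\<phi> \<^bold>\<and> Conj (\<psi> # \<phi>s))"

fun Disj :: "'m form list \<Rightarrow> 'm form" where
  "Disj [] = Bot"
| "Disj [\<phi>] = \<phi>"
| "Disj (\<phi> # \<psi> # \<phi>s) = (\<phi> \<^bold>\<or> Disj (\<psi> # \<phi>s))"

definition U_ge :: "real \<Rightarrow> 'm form \<Rightarrow> 'm form" where "U_ge p \<phi> = Prob p 0 \<phi>"
definition L_ge :: "real \<Rightarrow> 'm form \<Rightarrow> 'm form" where "L_ge p \<phi> = Prob 0 p \<phi>"
definition U_le :: "real \<Rightarrow> 'm form \<Rightarrow> 'm form" where "U_le p \<phi> = Prob 0 (1 - p) (\<^bold>\<not> \<phi>)"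
definition U_lt :: "real \<Rightarrow> 'm form \<Rightarrow> 'm form" where "U_lt p \<phi> = (\<^bold>\<not> U_ge p \<phi>)"


section \<open>Semantics\<close>

text \<open>\<open>box_sem X T \<alpha> \<kappa> S F\<close> is the meaning of \<open>[\<kappa>]\<phi>\<close> at sort \<open>S\<close>, when \<open>F S'\<close> is the meaning
  of \<open>\<phi>\<close> at sort \<open>S'\<close>.\<close>

fun box_sem :: "'x uspace \<Rightarrow> 'm func \<Rightarrow> ('x \<Rightarrow> ('x, 'm) pt) \<Rightarrow> label \<Rightarrow> 'm func \<Rightarrow>
    ('m func \<Rightarrow> ('x, 'm) pt set) \<Rightarrow> ('x, 'm) pt set" where
  "box_sem X T \<alpha> Pr1 (FProd S1 S2) F =
     {PPair u v | u v. PPair u v \<in> pts (functor_space X (FProd S1 S2)) \<and> u \<in> F S1}"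
| "box_sem X T \<alpha> Pr2 (FProd S1 S2) F =
     {PPair u v | u v. PPair u v \<in> pts (functor_space X (FProd S1 S2)) \<and> v \<in> F S2}"
| "box_sem X T \<alpha> In1 (FSum S1 S2) F = PIn1 ` F S1 \<union> PIn2 ` pts (functor_space X S2)"
| "box_sem X T \<alpha> In2 (FSum S1 S2) F = PIn1 ` pts (functor_space X S1) \<union> PIn2 ` F S2"
| "box_sem X T \<alpha> Next FId F = PBase ` {x \<in> pts X. \<alpha> x \<in> F T}"
| "box_sem X T \<alpha> _ _ F = {}"

primrec sem :: "'x uspace \<Rightarrow> 'm func \<Rightarrow> ('x \<Rightarrow> ('x, 'm) pt) \<Rightarrow> 'm form \<Rightarrow> 'm func \<Rightarrow>
    ('x, 'm) pt set" where
  "sem X T \<alpha> Bot S = {}"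
| "sem X T \<alpha> (\<phi> \<^bold>\<rightarrow> \<psi>) S = (pts (functor_space X S) - sem X T \<alpha> \<phi> S) \<union> sem X T \<alpha> \<psi> S"
| "sem X T \<alpha> (Cst A) S = PConst ` A"
| "sem X T \<alpha> (Box \<kappa> \<phi>) S = box_sem X T \<alpha> \<kappa> S (sem X T \<alpha> \<phi>)"
| "sem X T \<alpha> (Prob p q \<phi>) S =
     (case S of
        FDelta S' \<Rightarrow> encode (functor_space X S') ` beta (functor_space X S') p q (sem X T \<alpha> \<phi> S')
      | _ \<Rightarrow> {})"

definition entails :: "'m func \<Rightarrow> 'x uspace \<Rightarrow> ('x \<Rightarrow> ('x, 'm) pt) \<Rightarrow>
    'm func \<Rightarrow> 'm form set \<Rightarrow> 'm form \<Rightarrow> bool" where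
  "entails T X \<alpha> S \<Gamma> \<phi> \<longleftrightarrow>
     \<Gamma> \<subseteq> Form T S \<and> \<phi> \<in> Form T S \<and>
     (\<forall>x\<in>pts (functor_space X S). (\<forall>\<psi>\<in>\<Gamma>. x \<in> sem X T \<alpha> \<psi> S) \<longrightarrow> x \<in> sem X T \<alpha> \<phi> S)"


section \<open>Axioms\<close>

primrec beval :: "('m form \<Rightarrow> bool) \<Rightarrow> 'm form \<Rightarrow> bool" where
  "beval v Bot \<longleftrightarrow> False"
| "beval v (\<phi> \<^bold>\<rightarrow> \<psi>) \<longleftrightarrow> (beval v \<phi> \<longrightarrow> beval v \<psi>)"
| "beval v (Cst A) \<longleftrightarrow> v (Cst A)"
| "beval v (Box \<kappa> \<phi>) \<longleftrightarrow> v (Box \<kappa> \<phi>)"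
| "beval v (Prob p q \<phi>) \<longleftrightarrow> v (Prob p q \<phi>)"

definition tautology :: "'m form \<Rightarrow> bool" where
  "tautology \<phi> \<longleftrightarrow> (\<forall>v. beval v \<phi>)"

inductive_set Ax :: "'m func \<Rightarrow> 'm func \<Rightarrow> 'm form set" for T S where
  taut: "\<phi> \<in> Form T S \<Longrightarrow> tautology \<phi> \<Longrightarrow> \<phi> \<in> Ax T S"
| const_in: "S = FConst M \<Longrightarrow> c \<in> pts M \<Longrightarrow> Cst A \<in> Form T S \<Longrightarrow> c \<in> A \<Longrightarrow>
    (Cst {c} \<^bold>\<rightarrow> Cst A) \<in> Ax T S"
| const_notin: "S = FConst M \<Longrightarrow> c \<in> pts M \<Longrightarrow> Cst A \<in> Form T S \<Longrightarrow> c \<notin> A \<Longrightarrow>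
    (Cst {c} \<^bold>\<rightarrow> (\<^bold>\<not> Cst A)) \<in> Ax T S"
| box_neg: "label_from_to T \<kappa> S S' \<Longrightarrow> \<phi> \<in> Form T S' \<Longrightarrow>
    ((\<^bold>\<not> Box \<kappa> \<phi>) \<^bold>\<rightarrow> Box \<kappa> (\<^bold>\<not> \<phi>)) \<in> Ax T S"
| pr1: "S = FProd S1 S2 \<Longrightarrow> (\<^bold>\<not> Box Pr1 Bot) \<in> Ax T S"
| pr2: "S = FProd S1 S2 \<Longrightarrow> (\<^bold>\<not> Box Pr2 Bot) \<in> Ax T S"
| inj: "S = FSum S1 S2 \<Longrightarrow> ((\<^bold>\<not> Box In1 Bot) \<^bold>\<leftrightarrow> Box In2 Bot) \<in> Ax T S"
| nxt: "S = FId \<Longrightarrow> (\<^bold>\<not> Box Next Bot) \<in> Ax T S"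
| le_lt: "S = FDelta S' \<Longrightarrow> \<phi> \<in> MForm T S' \<Longrightarrow> p \<in> {0..1} \<Longrightarrow> q \<in> {0..1} \<Longrightarrow> p < q \<Longrightarrow>
    (U_le p \<phi> \<^bold>\<rightarrow> U_lt q \<phi>) \<in> Ax T S"
| lt_le: "S = FDelta S' \<Longrightarrow> \<phi> \<in> MForm T S' \<Longrightarrow> p \<in> {0..1} \<Longrightarrow>
    (U_lt p \<phi> \<^bold>\<rightarrow> U_le p \<phi>) \<in> Ax T S"
| upper_mono: "S = FDelta S' \<Longrightarrow> \<phi> \<in> MForm T S' \<Longrightarrow> \<psi> \<in> MForm T S' \<Longrightarrow> p \<in> {0..1} \<Longrightarrow>
    (L_ge 1 (\<phi> \<^bold>\<rightarrow> \<psi>) \<^bold>\<rightarrow> (U_ge p \<phi> \<^bold>\<rightarrow> U_ge p \<psi>)) \<in> Ax T S"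
| split: "S = FDelta S' \<Longrightarrow> \<phi> \<in> MForm T S' \<Longrightarrow> p \<in> {0..1} \<Longrightarrow> q \<in> {0..1} \<Longrightarrow>
    (Prob p q \<phi> \<^bold>\<leftrightarrow> (U_ge p \<phi> \<^bold>\<and> L_ge q \<phi>)) \<in> Ax T S"


section \<open>Inference rules\<close>

type_synonym 'm deriv = "'m func \<Rightarrow> 'm form set \<Rightarrow> 'm form \<Rightarrow> bool"

definition rule_assumption :: "'m func \<Rightarrow> 'm deriv \<Rightarrow> bool" where
  "rule_assumption T D \<longleftrightarrow>
     (\<forall>S\<in>Ing T. \<forall>\<Gamma>. \<Gamma> \<subseteq> Form T S \<longrightarrow> (\<forall>\<phi>\<in>\<Gamma> \<union> Ax T S. D S \<Gamma> \<phi>))"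

definition rule_modus_ponens :: "'m func \<Rightarrow> 'm deriv \<Rightarrow> bool" where
  "rule_modus_ponens T D \<longleftrightarrow>
     (\<forall>S\<in>Ing T. \<forall>\<phi>\<in>Form T S. \<forall>\<psi>\<in>Form T S. D S {\<phi>, \<phi> \<^bold>\<rightarrow> \<psi>} \<psi>)"

definition rule_cut :: "'m func \<Rightarrow> 'm deriv \<Rightarrow> bool" where
  "rule_cut T D \<longleftrightarrow>
     (\<forall>S\<in>Ing T. \<forall>\<Gamma> \<Lambda>. \<forall>\<phi>\<in>Form T S. \<Gamma> \<subseteq> Form T S \<longrightarrow> \<Lambda> \<subseteq> Form T S \<longrightarrow>
        (\<forall>\<psi>\<in>\<Lambda>. D S \<Gamma> \<psi>) \<longrightarrow> D S \<Lambda> \<phi> \<longrightarrow> D S \<Gamma> \<phi>)"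

definition rule_deduction :: "'m func \<Rightarrow> 'm deriv \<Rightarrow> bool" where
  "rule_deduction T D \<longleftrightarrow>
     (\<forall>S\<in>Ing T. \<forall>\<Gamma>. \<forall>\<phi>\<in>Form T S. \<forall>\<psi>\<in>Form T S. \<Gamma> \<subseteq> Form T S \<longrightarrow>
        D S (\<Gamma> \<union> {\<phi>}) \<psi> \<longrightarrow> D S \<Gamma> (\<phi> \<^bold>\<rightarrow> \<psi>))"

definition rule_necessitation :: "'m func \<Rightarrow> 'm deriv \<Rightarrow> bool" where
  "rule_necessitation T D \<longleftrightarrow>
     (\<forall>S. FDelta S \<in> Ing T \<longrightarrow> (\<forall>\<phi>\<in>MForm T S. D S {} \<phi> \<longrightarrow> D (FDelta S) {} (L_ge 1 \<phi>)))"

definition rule_constant :: "'m func \<Rightarrow> 'm deriv \<Rightarrow> bool" where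
  "rule_constant T D \<longleftrightarrow>
     (\<forall>M. FConst M \<in> Ing T \<longrightarrow> D (FConst M) {\<^bold>\<not> Cst {c} | c. c \<in> pts M} Bot)"

definition rule_definite_box :: "'m func \<Rightarrow> 'm deriv \<Rightarrow> bool" where
  "rule_definite_box T D \<longleftrightarrow>
     (\<forall>S\<in>Ing T. \<forall>S'\<in>Ing T. \<forall>\<kappa> \<Gamma>. \<forall>\<psi>\<in>Form T S'.
        label_from_to T \<kappa> S S' \<longrightarrow> \<Gamma> \<subseteq> Form T S' \<longrightarrow>
        D S' \<Gamma> \<psi> \<longrightarrow> D S (Box \<kappa> ` \<Gamma>) (Box \<kappa> \<psi>))"

definition rule_archimedean :: "'m func \<Rightarrow> 'm deriv \<Rightarrow> bool" where
  "rule_archimedean T D \<longleftrightarrow>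
     (\<forall>S. FDelta S \<in> Ing T \<longrightarrow> (\<forall>\<psi>\<in>MForm T S. \<forall>p\<in>{0..1}.
        D (FDelta S) {U_ge q \<psi> | q. q \<in> {0..1} \<and> q < p} (U_ge p \<psi>) \<and>
        D (FDelta S) {L_ge q \<psi> | q. q \<in> {0..1} \<and> q < p} (L_ge p \<psi>)))"

text \<open>\<open>cover m k \<phi>\<close> is \<open>\<Or>\<^bsub>I\<^esub> \<And>\<^bsub>i \<in> I\<^esub> \<phi> i\<close>, with \<open>I\<close> ranging over the \<open>k\<close>-element subsets of
  \<open>{1, \<dots>, m}\<close>.  The subsets are enumerated as the sublists of \<open>[1, \<dots>, m]\<close>, which fixes the order
  of the disjuncts and conjuncts.\<close>

definition cover :: "nat \<Rightarrow> nat \<Rightarrow> (nat \<Rightarrow> 'm form) \<Rightarrow> 'm form" where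
  "cover m k \<phi> =
     Disj (map (\<lambda>I. Conj (map \<phi> I)) (filter (\<lambda>I. length I = k) (subseqs [1..<Suc m])))"

definition rule_cover1 :: "'m func \<Rightarrow> 'm deriv \<Rightarrow> bool" where
  "rule_cover1 T D \<longleftrightarrow>
     (\<forall>S. FDelta S \<in> Ing T \<longrightarrow> (\<forall>(m::nat) (n::nat) (k::nat) \<phi> \<phi>s (p :: nat \<Rightarrow> real).
        n \<ge> 1 \<longrightarrow> \<phi> \<in> MForm T S \<longrightarrow> (\<forall>i\<in>{1..m}. \<phi>s i \<in> MForm T S \<and> p i \<in> {0..1}) \<longrightarrow>
        D S {} (\<phi> \<^bold>\<rightarrow> cover m (n + k) \<phi>s) \<longrightarrow>
        D S {} (cover m k \<phi>s) \<longrightarrow>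
        D (FDelta S) {}
          (Conj (map (\<lambda>i. U_le (p i) (\<phi>s i)) [1..<Suc m]) \<^bold>\<rightarrow>
           U_le (max 0 (min 1 (((\<Sum>i=1..m. p i) - real k) / real n))) \<phi>)))"

definition rule_cover2 :: "'m func \<Rightarrow> 'm deriv \<Rightarrow> bool" where
  "rule_cover2 T D \<longleftrightarrow>
     (\<forall>S. FDelta S \<in> Ing T \<longrightarrow> (\<forall>(m::nat) (k::nat) \<phi>s (p :: nat \<Rightarrow> real).
        (\<forall>i\<in>{1..m}. \<phi>s i \<in> MForm T S \<and> p i \<in> {0..1}) \<longrightarrow>
        D S {} (cover m k \<phi>s) \<longrightarrow>
        (\<Sum>i=1..m. p i) < real k \<longrightarrow>
        D (FDelta S) {} (\<^bold>\<not> Conj (map (\<lambda>i. U_le (p i) (\<phi>s i)) [1..<Suc m]))))"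

end

theory Submission
  imports Defs
begin

text \<open>Formulas with measurable constants denote measurable sets, so an upper probability measure
  \<open>g = sup \<mu>\<close> may be evaluated on them.  The probabilistic axioms and rules then reduce to statements
  about one finitely additive \<open>\<mu>\<close>; for the cover rules this is the inequality
  \<open>k + n \<mu>(U) \<le> \<Sum>\<^sub>i \<mu>(U\<^sub>i)\<close>, whose two sides pass to the supremum because \<open>\<mu> \<le> g\<close>.\<close>

section \<open>Finitely additive and upper probability measures\<close>

text \<open>The measurability restriction is forced: a singleton \<open>{c}\<close> is a formula of
  constant sort even when it is not in the algebra, so a general denotation need not be measurable,
  and an upper probability measure carries no information outside its algebra. Probability
  modalities therefore take arguments from \<open>MForm\<close> alone. The remaining modalities rest
  on determinacy. For every label, a point either satisfies all boxes or has a single successor at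
  which every box argument is evaluated. This dichotomy gives the axiom moving negation inside a
  box, and also the definite box rule for infinite premise sets. Points of sort
  \<open>FDelta S\<close> are encoded measures; injectivity of \<open>encode\<close> allows each
  modality to be read as an inequality about the measure itself. Since \<open>entails\<close> also
  demands that premises and conclusion have the right sort, every rule has a syntactic half besides
  the semantic one.\<close>

lemma fin_prob_Int_Diff:
  assumes "uncertainty_space A" "fin_prob A \<mu>" "U \<in> alg A" "V \<in> alg A"
  shows "\<mu> U = \<mu> (U \<inter> V) + \<mu> (U - V)"
proof -
  interpret algebra "pts A" "alg A" using assms(1) by (simp add: uncertainty_space_def)
  have "\<mu> ((U \<inter> V) \<union> (U - V)) = \<mu> (U \<inter> V) + \<mu> (U - V)"
    using assms by (intro additiveD[of "alg A"]) (auto simp: fin_prob_def)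
  moreover have "(U \<inter> V) \<union> (U - V) = U" by blast
  ultimately show ?thesis by simp
qed

lemma fin_prob_nonneg: "fin_prob A \<mu> \<Longrightarrow> U \<in> alg A \<Longrightarrow> 0 \<le> \<mu> U"
  by (auto simp: fin_prob_def)

lemma fin_prob_mono:
  assumes "uncertainty_space A" "fin_prob A \<mu>" "U \<in> alg A" "V \<in> alg A" "U \<subseteq> V"
  shows "\<mu> U \<le> \<mu> V"
proof -
  interpret algebra "pts A" "alg A" using assms(1) by (simp add: uncertainty_space_def)
  have "V \<inter> U = U" using assms(5) by blast
  then show ?thesis
    using fin_prob_Int_Diff[OF assms(1,2,4,3)] fin_prob_nonneg[OF assms(2), of "V - U"] assms(3,4)
    by auto
qed

text \<open>Inserting \<open>j\<close> into \<open>F\<close> splits \<open>W\<close> along \<open>U j\<close>, and the bound \<open>c\<close> drops by one on the part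
  inside \<open>U j\<close>; hence the generalisation over \<open>W\<close> and \<open>c\<close>.\<close>

lemma fin_prob_cover:
  assumes A: "uncertainty_space A" and \<mu>: "fin_prob A \<mu>" and F: "finite F"
    and U: "\<And>i. i \<in> F \<Longrightarrow> U i \<in> alg A"
    and W: "W \<in> alg A" "\<And>x. x \<in> W \<Longrightarrow> c \<le> real (card {i\<in>F. x \<in> U i})"
  shows "c * \<mu> W \<le> (\<Sum>i\<in>F. \<mu> (W \<inter> U i))"
  using F U W
proof (induction F arbitrary: W c rule: finite_induct)
  case empty
  show ?case
  \<comment> \<open>With no covering sets, a point of \<open>W\<close> forces \<open>c\<close> \<le>
    0. For empty \<open>W\<close> the number \<open>c\<close> is arbitrary and
    \<open>\<mu> {} = 0\<close> settles the claim.\<close>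
  proof (cases "W = {}")
    case True
    then show ?thesis using \<mu> by (simp add: fin_prob_def)
  next
    case False
    then show ?thesis
      using empty fin_prob_nonneg[OF \<mu> \<open>W \<in> alg A\<close>] by (auto intro: mult_nonpos_nonneg)
  qed
next
  case (insert j F)
  interpret algebra "pts A" "alg A" using A by (simp add: uncertainty_space_def)
  have Uj: "U j \<in> alg A" using insert.prems by blast
  \<comment> \<open>Since \<open>c\<close> is real, \<open>c - 1\<close> may become negative and no
    case \<open>c = 0\<close> has to be split off.\<close>
  have "(c - 1) * \<mu> (W \<inter> U j) \<le> (\<Sum>i\<in>F. \<mu> (W \<inter> U j \<inter> U i))"
  proof (rule insert.IH)
    fix x assume x: "x \<in> W \<inter> U j"
    then have "{i \<in> insert j F. x \<in> U i} = insert j {i\<in>F. x \<in> U i}" by blast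
    then show "c - 1 \<le> real (card {i\<in>F. x \<in> U i})"
      using insert.prems(3)[of x] insert.hyps x by simp
  qed (use insert.prems Uj in auto)
  moreover have "c * \<mu> (W - U j) \<le> (\<Sum>i\<in>F. \<mu> ((W - U j) \<inter> U i))"
  proof (rule insert.IH)
    fix x assume x: "x \<in> W - U j"
    then have "{i \<in> insert j F. x \<in> U i} = {i\<in>F. x \<in> U i}" by blast
    then show "c \<le> real (card {i\<in>F. x \<in> U i})"
      using insert.prems(3)[of x] x by simp
  qed (use insert.prems Uj in auto)
  moreover have "(\<Sum>i\<in>F. \<mu> (W \<inter> U i)) =
      (\<Sum>i\<in>F. \<mu> (W \<inter> U j \<inter> U i)) + (\<Sum>i\<in>F. \<mu> ((W - U j) \<inter> U i))"
    unfolding sum.distrib[symmetric]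
  proof (rule sum.cong[OF refl])
    fix i assume "i \<in> F"
    then have "W \<inter> U i \<in> alg A" using insert.prems by blast
    moreover have "W \<inter> U i \<inter> U j = W \<inter> U j \<inter> U i" "W \<inter> U i - U j = (W - U j) \<inter> U i" by blast+
    ultimately show "\<mu> (W \<inter> U i) = \<mu> (W \<inter> U j \<inter> U i) + \<mu> ((W - U j) \<inter> U i)"
      using fin_prob_Int_Diff[OF A \<mu> _ Uj, of "W \<inter> U i"] by simp
  qed
  moreover have "\<mu> W = \<mu> (W \<inter> U j) + \<mu> (W - U j)"
    using fin_prob_Int_Diff[OF A \<mu> insert.prems(2) Uj] .
  \<comment> \<open>The amount \<open>\<mu> (W \<inter> U j)\<close> lost through
    \<open>c - 1\<close> is exactly the summand of index \<open>j\<close>.\<close>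
  ultimately show ?case using insert.hyps by (simp add: algebra_simps)
qed

text \<open>The set \<open>V\<close> is covered \<open>n + k\<close> times and its complement
  \<open>k\<close> times. Adding both bounds gives
  \<open>(n + k) * \<mu> V + k * (1 - \<mu> V)\<close>, which equals \<open>k + n * \<mu> V\<close>.
  This is the necessity half of the Anger-Lembcke condition, for one measure.\<close>

lemma fin_prob_cover_le:
  assumes A: "uncertainty_space A" and \<mu>: "fin_prob A \<mu>" and F: "finite F"
    and Ui: "\<And>i. i \<in> F \<Longrightarrow> U i \<in> alg A" and V: "V \<in> alg A"
    and k: "\<And>x. x \<in> pts A \<Longrightarrow> k \<le> card {i\<in>F. x \<in> U i}"
    and n: "\<And>x. x \<in> V \<Longrightarrow> n + k \<le> card {i\<in>F. x \<in> U i}"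
  shows "real k + real n * \<mu> V \<le> (\<Sum>i\<in>F. \<mu> (U i))"
proof -
  interpret algebra "pts A" "alg A" using A by (simp add: uncertainty_space_def)
  have "real (n + k) * \<mu> V \<le> (\<Sum>i\<in>F. \<mu> (V \<inter> U i))"
    using n V by (intro fin_prob_cover[OF A \<mu> F Ui]) (auto simp flip: of_nat_add)
  moreover have "real k * \<mu> (pts A - V) \<le> (\<Sum>i\<in>F. \<mu> ((pts A - V) \<inter> U i))"
    using k V by (intro fin_prob_cover[OF A \<mu> F Ui]) auto
  moreover have "(\<Sum>i\<in>F. \<mu> (U i)) = (\<Sum>i\<in>F. \<mu> (V \<inter> U i)) + (\<Sum>i\<in>F. \<mu> ((pts A - V) \<inter> U i))"
    unfolding sum.distrib[symmetric]
  proof (rule sum.cong[OF refl])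
    fix i assume i: "i \<in> F"
    then have "U i \<subseteq> pts A" using Ui sets_into_space by blast
    then have "U i \<inter> V = V \<inter> U i" "U i - V = (pts A - V) \<inter> U i" by blast+
    then show "\<mu> (U i) = \<mu> (V \<inter> U i) + \<mu> ((pts A - V) \<inter> U i)"
      using fin_prob_Int_Diff[OF A \<mu> Ui[OF i] V] by simp
  qed
  moreover have "\<mu> (pts A - V) = 1 - \<mu> V"
  proof -
    have "pts A \<inter> V = V" using V sets_into_space by blast
    then show ?thesis using fin_prob_Int_Diff[OF A \<mu> top V] \<mu> by (simp add: fin_prob_def)
  qed
  ultimately have "real (n + k) * \<mu> V + real k * (1 - \<mu> V) \<le> (\<Sum>i\<in>F. \<mu> (U i))"
    by simp
  then show ?thesis by (simp add: algebra_simps)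
qed

section \<open>Upper probability measures as suprema\<close>

lemma upper_probs_sup:
  assumes "g \<in> upper_probs A"
  obtains P where "P \<noteq> {}" "\<And>\<mu>. \<mu> \<in> P \<Longrightarrow> fin_prob A \<mu>"
    "\<And>\<mu> U. \<mu> \<in> P \<Longrightarrow> U \<in> alg A \<Longrightarrow> \<mu> U \<le> g U"
    "\<And>U c. U \<in> alg A \<Longrightarrow> (\<And>\<mu>. \<mu> \<in> P \<Longrightarrow> \<mu> U \<le> c) \<Longrightarrow> g U \<le> c"
proof -
  obtain P where P: "P \<noteq> {}" "\<forall>\<mu>\<in>P. fin_prob A \<mu>" "\<forall>U\<in>alg A. g U = (SUP \<mu>\<in>P. \<mu> U)"
    using assms by (auto simp: upper_probs_def upper_prob_def)
  show ?thesis
  proof (rule that[of P])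
    fix \<mu> U assume \<mu>: "\<mu> \<in> P" and U: "U \<in> alg A"
    \<comment> \<open>Boundedness by 1 makes \<open>SUP\<close> on the reals an actual upper bound
      of the family.\<close>
    have "bdd_above ((\<lambda>\<mu>. \<mu> U) ` P)"
      using P(2) U by (intro bdd_aboveI[of _ 1]) (auto simp: fin_prob_def)
    then have "\<mu> U \<le> (SUP \<mu>\<in>P. \<mu> U)" using \<mu> by (rule cSUP_upper[rotated])
    then show "\<mu> U \<le> g U" using P(3) U by simp
  next
    fix U c assume "U \<in> alg A" "\<And>\<mu>. \<mu> \<in> P \<Longrightarrow> \<mu> U \<le> c"
    then show "g U \<le> c" using P(1,3) by (simp add: cSUP_least)
  qed (use P in auto)
qed

lemma upper_probs_bounds:
  assumes "g \<in> upper_probs A" "U \<in> alg A"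
  shows "0 \<le> g U" "g U \<le> 1"
proof -
  obtain P where P: "P \<noteq> {}" "\<And>\<mu>. \<mu> \<in> P \<Longrightarrow> fin_prob A \<mu>"
    "\<And>\<mu> U. \<mu> \<in> P \<Longrightarrow> U \<in> alg A \<Longrightarrow> \<mu> U \<le> g U"
    "\<And>U c. U \<in> alg A \<Longrightarrow> (\<And>\<mu>. \<mu> \<in> P \<Longrightarrow> \<mu> U \<le> c) \<Longrightarrow> g U \<le> c"
    using upper_probs_sup[OF assms(1)] by metis
  obtain \<mu> where "\<mu> \<in> P" using P(1) by blast
  then show "0 \<le> g U" using P(2,3) assms(2) fin_prob_nonneg order_trans by metis
  show "g U \<le> 1" using P(2,4) assms(2) by (auto simp: fin_prob_def)
qed

lemma upper_probs_empty:
  assumes "uncertainty_space A" "g \<in> upper_probs A"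
  shows "g {} = 0"
proof -
  have e: "{} \<in> alg A" using assms(1) by (simp add: uncertainty_space_def algebra_iff_Un)
  obtain P where "\<And>\<mu>. \<mu> \<in> P \<Longrightarrow> fin_prob A \<mu>"
    "\<And>U c. U \<in> alg A \<Longrightarrow> (\<And>\<mu>. \<mu> \<in> P \<Longrightarrow> \<mu> U \<le> c) \<Longrightarrow> g U \<le> c"
    using upper_probs_sup[OF assms(2)] by metis
  then have "g {} \<le> 0" using e by (metis fin_prob_def order_refl)
  then show ?thesis using upper_probs_bounds(1)[OF assms(2) e] by simp
qed

text \<open>Each \<mu> splits \<open>U\<close> along \<open>V\<close>. When \<open>U - V\<close> is
  the complement of an implication and has value 0, this yields \<open>g U\<close> \<le>
  \<open>g V\<close>, as the axiom \<open>upper_mono\<close> requires.\<close>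

lemma upper_probs_le_add_Diff:
  assumes A: "uncertainty_space A" and g: "g \<in> upper_probs A" and U: "U \<in> alg A" and V: "V \<in> alg A"
  shows "g U \<le> g V + g (U - V)"
proof -
  interpret algebra "pts A" "alg A" using A by (simp add: uncertainty_space_def)
  obtain P where P: "\<And>\<mu>. \<mu> \<in> P \<Longrightarrow> fin_prob A \<mu>"
    "\<And>\<mu> U. \<mu> \<in> P \<Longrightarrow> U \<in> alg A \<Longrightarrow> \<mu> U \<le> g U"
    "\<And>U c. U \<in> alg A \<Longrightarrow> (\<And>\<mu>. \<mu> \<in> P \<Longrightarrow> \<mu> U \<le> c) \<Longrightarrow> g U \<le> c"
    using upper_probs_sup[OF g] by metis
  show ?thesis
  proof (rule P(3)[OF U])
    fix \<mu> assume \<mu>: "\<mu> \<in> P"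
    have "\<mu> U = \<mu> (U \<inter> V) + \<mu> (U - V)" using fin_prob_Int_Diff[OF A P(1)[OF \<mu>] U V] .
    also have "\<dots> \<le> \<mu> V + \<mu> (U - V)" using fin_prob_mono[OF A P(1)[OF \<mu>], of "U \<inter> V" V] U V by auto
    also have "\<dots> \<le> g V + g (U - V)" using P(2)[OF \<mu>] U V by (intro add_mono) auto
    finally show "\<mu> U \<le> g V + g (U - V)" .
  qed
qed

text \<open>Allowing \<open>n = 0\<close> makes both cover rules instances: the second takes
  \<open>n = 0\<close> and \<open>V = {}\<close>.\<close>

lemma upper_probs_cover_le:
  assumes A: "uncertainty_space A" and g: "g \<in> upper_probs A" and F: "finite F"
    and Ui: "\<And>i. i \<in> F \<Longrightarrow> U i \<in> alg A" and V: "V \<in> alg A"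
    and k: "\<And>x. x \<in> pts A \<Longrightarrow> k \<le> card {i\<in>F. x \<in> U i}"
    and n: "\<And>x. x \<in> V \<Longrightarrow> n + k \<le> card {i\<in>F. x \<in> U i}"
  shows "real k + real n * g V \<le> (\<Sum>i\<in>F. g (U i))"
proof -
  obtain P where P: "P \<noteq> {}" "\<And>\<mu>. \<mu> \<in> P \<Longrightarrow> fin_prob A \<mu>"
    "\<And>\<mu> U. \<mu> \<in> P \<Longrightarrow> U \<in> alg A \<Longrightarrow> \<mu> U \<le> g U"
    "\<And>U c. U \<in> alg A \<Longrightarrow> (\<And>\<mu>. \<mu> \<in> P \<Longrightarrow> \<mu> U \<le> c) \<Longrightarrow> g U \<le> c"
    using upper_probs_sup[OF g] by metis
  have le: "real k + real n * \<mu> V \<le> (\<Sum>i\<in>F. g (U i))" if \<mu>: "\<mu> \<in> P" for \<mu>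
  proof -
    have "real k + real n * \<mu> V \<le> (\<Sum>i\<in>F. \<mu> (U i))"
      by (rule fin_prob_cover_le[OF A P(2)[OF \<mu>] F Ui V k n])
    also have "\<dots> \<le> (\<Sum>i\<in>F. g (U i))" by (intro sum_mono P(3)[OF \<mu>] Ui)
    finally show ?thesis .
  qed
  show ?thesis
  \<comment> \<open>For \<open>n = 0\<close> the value \<open>g V\<close> drops out and any single
    member of \<open>P\<close> suffices. For positive \<open>n\<close> the inequality is solved for
    \<open>\<mu> V\<close>, so that leastness of the supremum applies.\<close>
  proof (cases "n = 0")
    case True
    then show ?thesis using le P(1) by auto
  next
    case False
    then have "g V \<le> ((\<Sum>i\<in>F. g (U i)) - real k) / real n"
      using le by (intro P(4)[OF V]) (simp add: field_simps)
    then show ?thesis using False by (simp add: field_simps)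
  qed
qed

section \<open>Sorts\<close>

lemma poly_functor_Ing: "S \<in> Ing T \<Longrightarrow> poly_functor T \<Longrightarrow> poly_functor S"
  by (induction T) auto

text \<open>The label \<open>Next\<close> leads from \<open>FId\<close> back to the whole functor,
  hence the hypothesis on \<open>T\<close>.\<close>

lemma poly_functor_label:
  "label_from_to T \<kappa> S S' \<Longrightarrow> poly_functor T \<Longrightarrow> poly_functor S \<Longrightarrow> poly_functor S'"
  by (auto elim: label_from_to.cases)

lemma has_sort_connectives [simp]:
  "has_sort T (\<^bold>\<not> \<phi>) S \<longleftrightarrow> has_sort T \<phi> S"
  "has_sort T Top S"
  "has_sort T (\<phi> \<^bold>\<and> \<psi>) S \<longleftrightarrow> has_sort T \<phi> S \<and> has_sort T \<psi> S"
  "has_sort T (\<phi> \<^bold>\<leftrightarrow> \<psi>) S \<longleftrightarrow> has_sort T \<phi> S \<and> has_sort T \<psi> S"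
  by (auto simp: Neg_def Top_def And_def Iff_def)

lemma has_sort_Conj [simp]: "has_sort T (Conj \<phi>s) S \<longleftrightarrow> (\<forall>\<phi>\<in>set \<phi>s. has_sort T \<phi> S)"
  by (induction \<phi>s rule: Conj.induct) auto

lemma Form_iff: "\<phi> \<in> Form T S \<longleftrightarrow> has_sort T \<phi> S"
  by (simp add: Form_def)

lemma MForm_Imp: "\<phi> \<in> MForm T S \<Longrightarrow> \<psi> \<in> MForm T S \<Longrightarrow> (\<phi> \<^bold>\<rightarrow> \<psi>) \<in> MForm T S"
  by (auto simp: MForm_def Form_def)

lemma MForm_Neg: "\<phi> \<in> MForm T S \<Longrightarrow> (\<^bold>\<not> \<phi>) \<in> MForm T S"
  by (auto simp: MForm_def Form_def Neg_def)

lemma has_sort_Prob_MForm: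
  "\<phi> \<in> MForm T S \<Longrightarrow> p \<in> {0..1} \<Longrightarrow> q \<in> {0..1} \<Longrightarrow> has_sort T (Prob p q \<phi>) (FDelta S)"
  by (auto simp: MForm_def Form_def)

lemma has_sort_bounds:
  assumes "\<phi> \<in> MForm T S" "p \<in> {0..1}"
  shows "has_sort T (U_ge p \<phi>) (FDelta S)" "has_sort T (L_ge p \<phi>) (FDelta S)"
    "has_sort T (U_le p \<phi>) (FDelta S)" "has_sort T (U_lt p \<phi>) (FDelta S)"
  unfolding U_ge_def L_ge_def U_le_def U_lt_def has_sort_connectives
  using assms MForm_Neg[OF assms(1)] by (auto intro!: has_sort_Prob_MForm simp del: has_sort.simps)


section \<open>Semantics in a coalgebra\<close>

locale poly_coalgebra =
  fixes T :: "'m func" and X :: "'x uspace" and \<alpha> :: "'x \<Rightarrow> ('x, 'm) pt"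
  assumes poly: "poly_functor T" and coalg: "coalgebra T X \<alpha>"
begin

abbreviation fspace :: "'m func \<Rightarrow> ('x, 'm) pt uspace" where
  "fspace S \<equiv> functor_space X S"
abbreviation denote :: "'m form \<Rightarrow> 'm func \<Rightarrow> ('x, 'm) pt set" where
  "denote \<phi> S \<equiv> sem X T \<alpha> \<phi> S"

lemma uncertainty_space_X: "uncertainty_space X"
  using coalg by (simp add: coalgebra_def)

lemma coalgebra_map: "x \<in> pts X \<Longrightarrow> \<alpha> x \<in> pts (fspace T)"
  using coalg by (auto simp: coalgebra_def measurable_map_def)

lemma uncertainty_space_space: "poly_functor S \<Longrightarrow> uncertainty_space (fspace S)"
  by (rule uncertainty_space_functor_space[OF uncertainty_space_X])

lemma algebra_space: "poly_functor S \<Longrightarrow> algebra (pts (fspace S)) (alg (fspace S))"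
  using uncertainty_space_space by (simp add: uncertainty_space_def)

lemma pts_space:
  "pts (fspace FId) = PBase ` pts X"
  "pts (fspace (FConst M)) = PConst ` pts M"
  "pts (fspace (FProd S1 S2)) = {PPair u v | u v. u \<in> pts (fspace S1) \<and> v \<in> pts (fspace S2)}"
  "pts (fspace (FSum S1 S2)) = PIn1 ` pts (fspace S1) \<union> PIn2 ` pts (fspace S2)"
  "pts (fspace (FDelta S)) = encode (fspace S) ` upper_probs (fspace S)"
  by (auto simp: image_space_def prod_space_def sum_space_def upper_space_def image_Un image_image
      Plus_def)

text \<open>Complements are relative to the points of the space, so the connectives behave
  classically at those points; this is the source of the membership assumption here and
  below.\<close>

lemma denote_Imp [simp]:
  "x \<in> pts (fspace S) \<Longrightarrow> x \<in> denote (\<phi> \<^bold>\<rightarrow> \<psi>) S \<longleftrightarrow> (x \<in> denote \<phi> S \<longrightarrow> x \<in> denote \<psi> S)"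
  by auto

declare sem.simps(2) [simp del]

lemma denote_connectives [simp]:
  assumes "x \<in> pts (fspace S)"
  shows "x \<in> denote (\<^bold>\<not> \<phi>) S \<longleftrightarrow> x \<notin> denote \<phi> S"
    "x \<in> denote Top S"
    "x \<in> denote (\<phi> \<^bold>\<or> \<psi>) S \<longleftrightarrow> x \<in> denote \<phi> S \<or> x \<in> denote \<psi> S"
    "x \<in> denote (\<phi> \<^bold>\<and> \<psi>) S \<longleftrightarrow> x \<in> denote \<phi> S \<and> x \<in> denote \<psi> S"
    "x \<in> denote (\<phi> \<^bold>\<leftrightarrow> \<psi>) S \<longleftrightarrow> (x \<in> denote \<phi> S \<longleftrightarrow> x \<in> denote \<psi> S)"
  using assms by (auto simp: Neg_def Top_def Or_def And_def Iff_def)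

lemma denote_Conj:
  "x \<in> pts (fspace S) \<Longrightarrow> x \<in> denote (Conj \<phi>s) S \<longleftrightarrow> (\<forall>\<phi>\<in>set \<phi>s. x \<in> denote \<phi> S)"
  by (induction \<phi>s rule: Conj.induct) auto

lemma denote_Disj:
  "x \<in> pts (fspace S) \<Longrightarrow> x \<in> denote (Disj \<phi>s) S \<longleftrightarrow> (\<exists>\<phi>\<in>set \<phi>s. x \<in> denote \<phi> S)"
  by (induction \<phi>s rule: Disj.induct) auto

text \<open>A true disjunct is a sublist of a list without repetitions, so its \<open>k\<close>
  entries are distinct indices whose formulas all hold at \<open>x\<close>.\<close>

lemma denote_cover:
  assumes x: "x \<in> pts (fspace S)" and c: "x \<in> denote (cover m k \<phi>s) S"
  shows "k \<le> card {i\<in>{1..m}. x \<in> denote (\<phi>s i) S}"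
proof -
  obtain I where I: "I \<in> set (subseqs [1..<Suc m])" "length I = k" "x \<in> denote (Conj (map \<phi>s I)) S"
    using c denote_Disj[OF x] unfolding cover_def by auto
  have "set I \<in> Pow (set [1..<Suc m])" unfolding subseqs_powset[symmetric] by (rule imageI[OF I(1)])
  then have "set I \<subseteq> {1..m}" by auto
  then have "set I \<subseteq> {i\<in>{1..m}. x \<in> denote (\<phi>s i) S}" using I(3) denote_Conj[OF x] by auto
  then have "card (set I) \<le> card {i\<in>{1..m}. x \<in> denote (\<phi>s i) S}" by (intro card_mono) auto
  moreover have "card (set I) = k"
    using distinct_card[OF subseqs_distinctD[OF I(1) distinct_upt]] I(2) by simp
  ultimately show ?thesis by simp
qed

text \<open>Atoms are the formulas other than \<open>Bot\<close> and implications, so the boolean value of a formula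
  under the valuation read off from a point is its truth at that point.\<close>

lemma beval_denote:
  "x \<in> pts (fspace S) \<Longrightarrow> beval (\<lambda>\<psi>. x \<in> denote \<psi> S) \<phi> \<longleftrightarrow> x \<in> denote \<phi> S"
  by (induction \<phi>) (auto simp del: sem.simps(3-5))

section \<open>Measurability of denotations\<close>

lemma alg_prod_rectangle:
  assumes "U \<in> alg (fspace S1)" "V \<in> alg (fspace S2)"
  shows "{PPair u v | u v. u \<in> U \<and> v \<in> V} \<in> alg (fspace (FProd S1 S2))"
proof -
  have "U \<times> V \<in> alg (prod_space (fspace S1) (fspace S2))"
    using assms unfolding prod_space_def snd_conv by (intro hull_inc) blast
  then have "case_prod PPair ` (U \<times> V) \<in> alg (fspace (FProd S1 S2))" by (auto simp: image_space_def)
  moreover have "case_prod PPair ` (U \<times> V) = {PPair u v | u v. u \<in> U \<and> v \<in> V}" by auto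
  ultimately show ?thesis by simp
qed

text \<open>A box along one injection holds throughout the other summand, so its denotation combines
  a generator from each side.\<close>

lemma alg_sum_union:
  assumes poly12: "poly_functor S1" "poly_functor S2" and UV: "U \<in> alg (fspace S1)" "V \<in> alg (fspace S2)"
  shows "PIn1 ` U \<union> PIn2 ` V \<in> alg (fspace (FSum S1 S2))"
proof -
  interpret algebra "pts (sum_space (fspace S1) (fspace S2))" "alg (sum_space (fspace S1) (fspace S2))"
    using uncertainty_space_sum_space uncertainty_space_space poly12
    unfolding uncertainty_space_def by blast
  have "Inl ` U \<in> alg (sum_space (fspace S1) (fspace S2))"
    "Inr ` V \<in> alg (sum_space (fspace S1) (fspace S2))"
    using UV unfolding sum_space_def snd_conv by (intro hull_inc; blast)+
  then have "Inl ` U \<union> Inr ` V \<in> alg (sum_space (fspace S1) (fspace S2))" by blast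
  then have "case_sum PIn1 PIn2 ` (Inl ` U \<union> Inr ` V) \<in> alg (fspace (FSum S1 S2))"
    by (auto simp: image_space_def)
  then show ?thesis by (simp add: image_Un image_image)
qed

lemma denote_Box_measurable:
  assumes \<kappa>: "label_from_to T \<kappa> S S'" and S: "poly_functor S" and m: "denote \<phi> S' \<in> alg (fspace S')"
  shows "denote (Box \<kappa> \<phi>) S \<in> alg (fspace S)"
  using \<kappa>
proof cases
  case (1 S2)
  interpret B: algebra "pts (fspace S2)" "alg (fspace S2)" using algebra_space S 1 by simp
  interpret A: algebra "pts (fspace S')" "alg (fspace S')" using algebra_space S 1 by simp
  have "denote (Box \<kappa> \<phi>) S = {PPair u v | u v. u \<in> denote \<phi> S' \<and> v \<in> pts (fspace S2)}"
    using 1 A.sets_into_space[OF m] by (auto simp: pts_space simp del: functor_space.simps)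
  then show ?thesis using alg_prod_rectangle[OF m B.top] 1 by simp
next
  case (2 S1)
  interpret B: algebra "pts (fspace S1)" "alg (fspace S1)" using algebra_space S 2 by simp
  interpret A: algebra "pts (fspace S')" "alg (fspace S')" using algebra_space S 2 by simp
  have "denote (Box \<kappa> \<phi>) S = {PPair u v | u v. u \<in> pts (fspace S1) \<and> v \<in> denote \<phi> S'}"
    using 2 A.sets_into_space[OF m] by (auto simp: pts_space simp del: functor_space.simps)
  then show ?thesis using alg_prod_rectangle[OF B.top m] 2 by simp
next
  case (3 S2)
  interpret B: algebra "pts (fspace S2)" "alg (fspace S2)" using algebra_space S 3 by simp
  show ?thesis using alg_sum_union[OF _ _ m B.top] S 3 by simp
next
  case (4 S1)
  interpret B: algebra "pts (fspace S1)" "alg (fspace S1)" using algebra_space S 4 by simp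
  show ?thesis using alg_sum_union[OF _ _ B.top m] S 4 by simp
next
  case 5
  \<comment> \<open>Measurability of the coalgebra map enters here: the denotation is a preimage
    under \<alpha>, copied by \<open>PBase\<close>.\<close>
  have "\<alpha> -` denote \<phi> T \<inter> pts X \<in> alg X"
    using m 5 coalg by (auto simp: coalgebra_def measurable_map_def)
  moreover have "\<alpha> -` denote \<phi> T \<inter> pts X = {x \<in> pts X. \<alpha> x \<in> denote \<phi> T}" by blast
  ultimately show ?thesis using 5 by (simp add: image_space_def)
qed

lemma denote_measurable:
  assumes "\<phi> \<in> MForm T S" "poly_functor S"
  shows "denote \<phi> S \<in> alg (fspace S)"
proof -
  have "has_sort T \<phi> S \<Longrightarrow> meas_consts T \<phi> S \<Longrightarrow> poly_functor S \<Longrightarrow> denote \<phi> S \<in> alg (fspace S)"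
  proof (induction \<phi> arbitrary: S)
    case Bot
    interpret algebra "pts (fspace S)" "alg (fspace S)" using algebra_space Bot by simp
    show ?case by simp
  next
    case (Imp \<phi> \<psi>)
    interpret algebra "pts (fspace S)" "alg (fspace S)" using algebra_space Imp by simp
    show ?case using Imp by (auto simp: sem.simps(2))
  next
    case (Cst A)
    then obtain M where "S = FConst M" "A \<in> alg M" by auto
    then show ?case by (simp add: image_space_def)
  next
    case (Box \<kappa> \<phi>)
    then obtain S1 S2 where S: "label_from_to T \<kappa> S S1" "has_sort T \<phi> S1"
      "label_from_to T \<kappa> S S2" "meas_consts T \<phi> S2" by auto
    \<comment> \<open>\<open>has_sort\<close> and \<open>meas_consts\<close> each supply their own
      target sort; label and source determine it, so the two agree.\<close>
    moreover have "S1 = S2" using S(1,3) by (auto elim!: label_from_to.cases)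
    moreover have "poly_functor S1" using poly_functor_label[OF S(1) poly Box.prems(3)] .
    ultimately show ?case using Box by (intro denote_Box_measurable) auto
  next
    case (Prob p q \<phi>)
    then obtain S' where S: "S = FDelta S'" and m: "denote \<phi> S' \<in> alg (fspace S')" by auto
    \<comment> \<open>Sorting keeps \<open>p\<close> and \<open>q\<close> in the unit interval, so
      this set is a generator of the algebra.\<close>
    have "beta (fspace S') p q (denote \<phi> S') \<in> alg (upper_space (fspace S'))"
      using m Prob.prems unfolding upper_space_def snd_conv by (intro hull_inc) auto
    then show ?case using S by (simp add: image_space_def)
  qed
  then show ?thesis using assms by (auto simp: MForm_def Form_def)
qed

section \<open>Probability modalities as inequalities about a measure\<close>

lemma denote_Prob:
  assumes S: "poly_functor S" and g: "g \<in> upper_probs (fspace S)"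
  shows "encode (fspace S) g \<in> denote (Prob p q \<phi>) (FDelta S) \<longleftrightarrow>
    p \<le> g (denote \<phi> S) \<and> q \<le> 1 - g (pts (fspace S) - denote \<phi> S)"
proof -
  \<comment> \<open>Injectivity ensures that an encoded measure lies in the image of
    \<open>beta\<close> through that measure itself and not through another one with the same
    code.\<close>
  have inj: "inj_on (encode (fspace S)) (upper_probs (fspace S))"
    using inj_on_encode[OF uncertainty_space_X S] by (simp add: upper_space_def)
  have "encode (fspace S) g \<in> denote (Prob p q \<phi>) (FDelta S) \<longleftrightarrow>
      g \<in> beta (fspace S) p q (denote \<phi> S)"
    using inj_on_image_mem_iff[OF inj g, of "beta (fspace S) p q (denote \<phi> S)"]
    by (auto simp: beta_def)
  then show ?thesis using g by (simp add: beta_def)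
qed

text \<open>\<open>U_ge\<close>, \<open>L_ge\<close> and \<open>U_le\<close> each contain one
  comparison with 0, which holds because \<open>g\<close> has values in the unit interval. For
  \<open>U_le\<close> the denotation of a negation is complemented again, which returns the
  denotation of \<phi>.\<close>

lemma denote_bounds:
  assumes S: "poly_functor S" and \<phi>: "\<phi> \<in> MForm T S" and g: "g \<in> upper_probs (fspace S)"
  shows "encode (fspace S) g \<in> denote (U_ge p \<phi>) (FDelta S) \<longleftrightarrow> p \<le> g (denote \<phi> S)"
    and "encode (fspace S) g \<in> denote (L_ge p \<phi>) (FDelta S) \<longleftrightarrow>
      p \<le> 1 - g (pts (fspace S) - denote \<phi> S)"
    and "encode (fspace S) g \<in> denote (U_le p \<phi>) (FDelta S) \<longleftrightarrow> g (denote \<phi> S) \<le> p"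
    and "encode (fspace S) g \<in> denote (U_lt p \<phi>) (FDelta S) \<longleftrightarrow> g (denote \<phi> S) < p"
proof -
  interpret algebra "pts (fspace S)" "alg (fspace S)" by (rule algebra_space[OF S])
  have m: "denote \<phi> S \<in> alg (fspace S)" by (rule denote_measurable[OF \<phi> S])
  have c: "pts (fspace S) - denote \<phi> S \<in> alg (fspace S)" using m by blast
  have n: "denote (\<^bold>\<not> \<phi>) S = pts (fspace S) - denote \<phi> S" by (simp add: Neg_def sem.simps(2))
  have d: "pts (fspace S) - (pts (fspace S) - denote \<phi> S) = denote \<phi> S"
    using sets_into_space[OF m] by blast
  note b = upper_probs_bounds[OF g m] upper_probs_bounds[OF g c]
  show ge: "encode (fspace S) g \<in> denote (U_ge p \<phi>) (FDelta S) \<longleftrightarrow> p \<le> g (denote \<phi> S)"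
    unfolding U_ge_def denote_Prob[OF S g] using b by auto
  show "encode (fspace S) g \<in> denote (L_ge p \<phi>) (FDelta S) \<longleftrightarrow>
      p \<le> 1 - g (pts (fspace S) - denote \<phi> S)"
    unfolding L_ge_def denote_Prob[OF S g] using b by auto
  show "encode (fspace S) g \<in> denote (U_le p \<phi>) (FDelta S) \<longleftrightarrow> g (denote \<phi> S) \<le> p"
    unfolding U_le_def denote_Prob[OF S g] n d using b by auto
  have "encode (fspace S) g \<in> pts (fspace (FDelta S))" using g by (simp only: pts_space) blast
  then show "encode (fspace S) g \<in> denote (U_lt p \<phi>) (FDelta S) \<longleftrightarrow> g (denote \<phi> S) < p"
    unfolding U_lt_def denote_connectives(1)[OF \<open>encode (fspace S) g \<in> pts (fspace (FDelta S))\<close>] ge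
    by auto
qed


section \<open>Soundness of the axioms\<close>

text \<open>The syntactic half of Assumption: \<open>entails\<close> requires its conclusion to be a
  formula of the given sort.\<close>

lemma Ax_Form: "\<phi> \<in> Ax T S \<Longrightarrow> \<phi> \<in> Form T S"
proof (induction rule: Ax.induct)
  case (lt_le S' \<phi> p)
  then show ?case by (simp add: Form_iff has_sort_bounds)
next
  case (upper_mono S' \<phi> \<psi> p)
  then show ?case by (simp add: Form_iff has_sort_bounds MForm_Imp)
next
  case (split S' \<phi> p q)
  then have "has_sort T (Prob p q \<phi>) (FDelta S')" by (intro has_sort_Prob_MForm)
  then show ?case using split
    by (simp add: Form_iff has_sort_bounds del: has_sort.simps(5))
qed (auto simp: Form_iff has_sort_bounds intro: label_from_to.intros)

text \<open>The first alternative occurs for the labels \<open>In1\<close> and \<open>In2\<close> at a point of the other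
  summand.\<close>

lemma denote_Box_cases:
  assumes \<kappa>: "label_from_to T \<kappa> S S'" and x: "x \<in> pts (fspace S)"
  obtains "\<And>\<phi>. x \<in> denote (Box \<kappa> \<phi>) S"
  | y where "y \<in> pts (fspace S')" "\<And>\<phi>. x \<in> denote (Box \<kappa> \<phi>) S \<longleftrightarrow> y \<in> denote \<phi> S'"
  using \<kappa>
proof cases
  case (1 S2)
  then obtain u v where "x = PPair u v" "u \<in> pts (fspace S')" "v \<in> pts (fspace S2)"
    using x by (auto simp: pts_space simp del: functor_space.simps)
  then show ?thesis using 1
    by (intro that(2)[of u]) (auto simp: pts_space simp del: functor_space.simps)
next
  case (2 S1)
  then obtain u v where "x = PPair u v" "u \<in> pts (fspace S1)" "v \<in> pts (fspace S')"
    using x by (auto simp: pts_space simp del: functor_space.simps)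
  then show ?thesis using 2
    by (intro that(2)[of v]) (auto simp: pts_space simp del: functor_space.simps)
next
  case (3 S2)
  then consider u where "x = PIn1 u" "u \<in> pts (fspace S')" | v where "x = PIn2 v" "v \<in> pts (fspace S2)"
    using x by (auto simp: pts_space simp del: functor_space.simps)
  then show ?thesis
  proof cases
    case (1 u)
    then show ?thesis using 3 by (intro that(2)[of u]) auto
  next
    case (2 v)
    then show ?thesis using 3 by (intro that(1)) auto
  qed
next
  case (4 S1)
  then consider u where "x = PIn1 u" "u \<in> pts (fspace S1)" | v where "x = PIn2 v" "v \<in> pts (fspace S')"
    using x by (auto simp: pts_space simp del: functor_space.simps)
  then show ?thesis
  proof cases
    case (1 u)
    then show ?thesis using 4 by (intro that(1)) auto
  next
    case (2 v)
    then show ?thesis using 4 by (intro that(2)[of v]) auto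
  qed
next
  case 5
  then obtain u where "x = PBase u" "u \<in> pts X"
    using x by (auto simp: pts_space simp del: functor_space.simps)
  then show ?thesis using 5 coalgebra_map by (intro that(2)[of "\<alpha> u"]) auto
qed

text \<open>Where the box over \<phi> fails, the vacuous alternative is ruled out, so a successor
  exists and refutes \<phi>.\<close>

lemma denote_Box_Neg:
  assumes "label_from_to T \<kappa> S S'" "x \<in> pts (fspace S)" "x \<notin> denote (Box \<kappa> \<phi>) S"
  shows "x \<in> denote (Box \<kappa> (\<^bold>\<not> \<phi>)) S"
  using denote_Box_cases[OF assms(1,2)]
proof cases
  case (2 y)
  then show ?thesis using assms(3) denote_connectives(1)[OF 2(1)] by blast
qed blast

lemma Ax_sound:
  assumes S: "poly_functor S" and \<phi>: "\<phi> \<in> Ax T S" and x: "x \<in> pts (fspace S)"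
  shows "x \<in> denote \<phi> S"
  using \<phi>
proof cases
  case taut
  then show ?thesis using beval_denote[OF x] by (auto simp: tautology_def)
next
  case (box_neg \<kappa> S' \<psi>)
  then show ?thesis using denote_Box_Neg x by (simp del: sem.simps)
next
  case (le_lt S' \<psi> p q)
  then obtain g where g: "x = encode (fspace S') g" "g \<in> upper_probs (fspace S')"
    using x by (auto simp: pts_space simp del: functor_space.simps)
  then show ?thesis using le_lt S x by (simp add: denote_bounds del: functor_space.simps sem.simps)
next
  case (lt_le S' \<psi> p)
  then obtain g where g: "x = encode (fspace S') g" "g \<in> upper_probs (fspace S')"
    using x by (auto simp: pts_space simp del: functor_space.simps)
  then show ?thesis using lt_le S x by (simp add: denote_bounds del: functor_space.simps sem.simps)
next
  case (upper_mono S' \<psi> \<theta> p)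
  then obtain g where g: "x = encode (fspace S') g" "g \<in> upper_probs (fspace S')"
    using x by (auto simp: pts_space simp del: functor_space.simps)
  have S': "poly_functor S'" using S upper_mono by simp
  interpret algebra "pts (fspace S')" "alg (fspace S')" by (rule algebra_space[OF S'])
  have m: "denote \<psi> S' \<in> alg (fspace S')" "denote \<theta> S' \<in> alg (fspace S')"
    using upper_mono S' by (auto intro: denote_measurable)
  \<comment> \<open>\<open>L_ge 1\<close> of the implication says that \<open>g\<close> is at most 0
    on this complement.\<close>
  have "pts (fspace S') - denote (\<psi> \<^bold>\<rightarrow> \<theta>) S' = denote \<psi> S' - denote \<theta> S'"
    using sets_into_space[OF m(1)] by (auto simp: sem.simps(2))
  moreover have "g (denote \<psi> S') \<le> g (denote \<theta> S') + g (denote \<psi> S' - denote \<theta> S')"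
    by (rule upper_probs_le_add_Diff[OF uncertainty_space_space[OF S'] g(2) m])
  ultimately show ?thesis
    using upper_mono g S' x by (simp add: denote_bounds MForm_Imp del: functor_space.simps sem.simps)
next
  case (split S' \<psi> p q)
  then obtain g where g: "x = encode (fspace S') g" "g \<in> upper_probs (fspace S')"
    using x by (auto simp: pts_space simp del: functor_space.simps)
  then show ?thesis
    using split S x by (simp add: denote_bounds denote_Prob del: functor_space.simps sem.simps)
\<comment> \<open>The constant, projection, injection and next axioms remain.
  \<open>Box In1 Bot\<close> denotes the whole second summand and \<open>Box In2 Bot\<close> the
  whole first, so they are complementary.\<close>
qed (use x in \<open>auto simp: pts_space simp del: functor_space.simps\<close>)


section \<open>Soundness of the rules\<close>

abbreviation derives :: "'m deriv" where "derives \<equiv> entails T X \<alpha>"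

lemma sound_assumption: "rule_assumption T derives"
  unfolding rule_assumption_def entails_def
  using Ax_Form Ax_sound poly_functor_Ing[OF _ poly] by blast

lemma sound_modus_ponens: "rule_modus_ponens T derives"
  unfolding rule_modus_ponens_def entails_def by (auto simp: Form_iff)

lemma sound_cut: "rule_cut T derives"
  unfolding rule_cut_def entails_def by blast

lemma sound_deduction: "rule_deduction T derives"
  unfolding rule_deduction_def entails_def by (auto simp: Form_iff)

lemma sound_necessitation: "rule_necessitation T derives"
  unfolding rule_necessitation_def
proof (intro allI impI ballI)
  fix S \<phi> assume Ing: "FDelta S \<in> Ing T" and \<phi>: "\<phi> \<in> MForm T S" and D: "derives S {} \<phi>"
  have S: "poly_functor S" using poly_functor_Ing[OF Ing poly] by simp
  \<comment> \<open>Validity of \<phi> leaves an empty complement, and \<open>g {} = 0\<close> then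
    gives lower probability 1.\<close>
  have e: "pts (fspace S) - denote \<phi> S = {}" using D by (auto simp: entails_def)
  have "encode (fspace S) g \<in> denote (L_ge 1 \<phi>) (FDelta S)" if "g \<in> upper_probs (fspace S)" for g
    using denote_bounds(2)[OF S \<phi> that] upper_probs_empty[OF uncertainty_space_space[OF S] that]
    unfolding e by simp
  then show "derives (FDelta S) {} (L_ge 1 \<phi>)"
    using has_sort_bounds(2)[OF \<phi>] unfolding entails_def pts_space Form_iff by auto
qed

text \<open>Every point is \<open>PConst c\<close> for some \<open>c\<close> and refutes the premise
  about that \<open>c\<close>, so no point satisfies all premises.\<close>

lemma sound_constant: "rule_constant T derives"
  unfolding rule_constant_def entails_def
  by (auto simp: pts_space Form_iff simp del: functor_space.simps)

text \<open>The successor is fixed before any formula is considered, so a single point satisfies all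
  of \<Gamma> and hence \<psi>.\<close>

lemma sound_definite_box: "rule_definite_box T derives"
  unfolding rule_definite_box_def
proof (intro allI impI ballI)
  fix S S' \<kappa> \<Gamma> \<psi>
  assume \<kappa>: "label_from_to T \<kappa> S S'" and D: "derives S' \<Gamma> \<psi>"
  have sorts: "Box \<kappa> ` \<Gamma> \<subseteq> Form T S" "Box \<kappa> \<psi> \<in> Form T S"
    using D has_sort.simps(4)[of T \<kappa> _ S] \<kappa> unfolding entails_def Form_def by blast+
  have D: "x \<in> denote \<psi> S'" if "x \<in> pts (fspace S')" "\<And>\<phi>. \<phi> \<in> \<Gamma> \<Longrightarrow> x \<in> denote \<phi> S'" for x
    using D that by (auto simp: entails_def)
  have "x \<in> denote (Box \<kappa> \<psi>) S"
    if x: "x \<in> pts (fspace S)" and \<Gamma>: "\<And>\<phi>. \<phi> \<in> \<Gamma> \<Longrightarrow> x \<in> denote (Box \<kappa> \<phi>) S" for x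
    using denote_Box_cases[OF \<kappa> x]
  proof cases
    case (2 y)
    then show ?thesis using D[OF 2(1)] \<Gamma> by blast
  qed blast
  then show "derives S (Box \<kappa> ` \<Gamma>) (Box \<kappa> \<psi>)" using sorts by (auto simp: entails_def)
qed

text \<open>The Archimedean premises speak of \<open>q\<close> in the unit interval, while density
  of the reals asks for all \<open>q < p\<close>; negative \<open>q\<close> are handled by 0 \<le>
  \<open>a\<close>. At \<open>p = 0\<close> the premise set is empty and 0 \<le> \<open>a\<close> is
  the whole argument.\<close>

lemma le_if_unit_interval_below:
  fixes p a :: real
  assumes "0 \<le> a" "\<And>q. q \<in> {0..1} \<Longrightarrow> q < p \<Longrightarrow> q \<le> a" "p \<le> 1"
  shows "p \<le> a"
proof (rule dense_le)
  fix q assume "q < p"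
  then show "q \<le> a" using assms by (cases "0 \<le> q") auto
qed

lemma sound_archimedean: "rule_archimedean T derives"
  unfolding rule_archimedean_def
proof (intro allI impI ballI)
  fix S \<psi> and p :: real
  assume Ing: "FDelta S \<in> Ing T" and \<psi>: "\<psi> \<in> MForm T S" and p: "p \<in> {0..1}"
  have S: "poly_functor S" using poly_functor_Ing[OF Ing poly] by simp
  interpret algebra "pts (fspace S)" "alg (fspace S)" by (rule algebra_space[OF S])
  have m: "denote \<psi> S \<in> alg (fspace S)" "pts (fspace S) - denote \<psi> S \<in> alg (fspace S)"
    using denote_measurable[OF \<psi> S] by auto
  have U: "encode (fspace S) g \<in> denote (U_ge p \<psi>) (FDelta S)"
    if "g \<in> upper_probs (fspace S)"
      "\<And>q. q \<in> {0..1} \<Longrightarrow> q < p \<Longrightarrow> encode (fspace S) g \<in> denote (U_ge q \<psi>) (FDelta S)" for g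
    unfolding denote_bounds(1)[OF S \<psi> that(1)]
  proof (rule le_if_unit_interval_below)
    show "q \<le> g (denote \<psi> S)" if "q \<in> {0..1}" "q < p" for q
      using \<open>\<And>q. q \<in> {0..1} \<Longrightarrow> q < p \<Longrightarrow> encode (fspace S) g \<in> _\<close>[OF that]
      unfolding denote_bounds(1)[OF S \<psi> \<open>g \<in> upper_probs (fspace S)\<close>] .
  qed (use p upper_probs_bounds[OF that(1) m(1)] in simp_all)
  have L: "encode (fspace S) g \<in> denote (L_ge p \<psi>) (FDelta S)"
    if "g \<in> upper_probs (fspace S)"
      "\<And>q. q \<in> {0..1} \<Longrightarrow> q < p \<Longrightarrow> encode (fspace S) g \<in> denote (L_ge q \<psi>) (FDelta S)" for g
    unfolding denote_bounds(2)[OF S \<psi> that(1)]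
  proof (rule le_if_unit_interval_below)
    show "q \<le> 1 - g (pts (fspace S) - denote \<psi> S)" if "q \<in> {0..1}" "q < p" for q
      using \<open>\<And>q. q \<in> {0..1} \<Longrightarrow> q < p \<Longrightarrow> encode (fspace S) g \<in> _\<close>[OF that]
      unfolding denote_bounds(2)[OF S \<psi> \<open>g \<in> upper_probs (fspace S)\<close>] .
  \<comment> \<open>Here the nonnegative quantity is 1 minus the value on the complement, so the
    bound \<open>g\<close> \<le> 1 is what counts.\<close>
  qed (use p upper_probs_bounds[OF that(1) m(2)] in simp_all)
  show "derives (FDelta S) {U_ge q \<psi> | q. q \<in> {0..1} \<and> q < p} (U_ge p \<psi>) \<and>
      derives (FDelta S) {L_ge q \<psi> | q. q \<in> {0..1} \<and> q < p} (L_ge p \<psi>)"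
    unfolding entails_def pts_space
  proof (intro conjI ballI impI)
    fix x assume "x \<in> encode (fspace S) ` upper_probs (fspace S)"
      and a: "\<forall>\<phi>\<in>{U_ge q \<psi> | q. q \<in> {0..1} \<and> q < p}. x \<in> denote \<phi> (FDelta S)"
    then obtain g where g: "x = encode (fspace S) g" "g \<in> upper_probs (fspace S)" by blast
    show "x \<in> denote (U_ge p \<psi>) (FDelta S)" unfolding g(1)
      by (rule U[OF g(2)]) (use a g(1) in blast)
  next
    fix x assume "x \<in> encode (fspace S) ` upper_probs (fspace S)"
      and a: "\<forall>\<phi>\<in>{L_ge q \<psi> | q. q \<in> {0..1} \<and> q < p}. x \<in> denote \<phi> (FDelta S)"
    then obtain g where g: "x = encode (fspace S) g" "g \<in> upper_probs (fspace S)" by blast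
    show "x \<in> denote (L_ge p \<psi>) (FDelta S)" unfolding g(1)
      by (rule L[OF g(2)]) (use a g(1) in blast)
  qed (use has_sort_bounds[OF \<psi>] p in \<open>auto simp: Form_iff\<close>)
qed

section \<open>Cover rules\<close>

lemma denote_Conj_U_le:
  assumes S: "poly_functor S" and \<phi>s: "\<And>i. i \<in> {1..m} \<Longrightarrow> \<phi>s i \<in> MForm T S"
    and g: "g \<in> upper_probs (fspace S)"
  shows "encode (fspace S) g \<in> denote (Conj (map (\<lambda>i. U_le (p i) (\<phi>s i)) [1..<Suc m])) (FDelta S)
    \<longleftrightarrow> (\<forall>i\<in>{1..m}. g (denote (\<phi>s i) S) \<le> p i)"
proof -
  have x: "encode (fspace S) g \<in> pts (fspace (FDelta S))" using g by (simp only: pts_space) blast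
  have set: "set [1..<Suc m] = {1..m}" by auto
  show ?thesis
    unfolding denote_Conj[OF x] set_map set using denote_bounds(3)[OF S \<phi>s g] by auto
qed

lemma derives_cover:
  "derives S {} (cover m k \<phi>s) \<Longrightarrow> x \<in> pts (fspace S) \<Longrightarrow>
    k \<le> card {i\<in>{1..m}. x \<in> denote (\<phi>s i) S}"
  by (intro denote_cover) (auto simp: entails_def)

lemma sound_cover1: "rule_cover1 T derives"
  unfolding rule_cover1_def
proof (intro allI impI)
  fix S m n k \<phi> \<phi>s and p :: "nat \<Rightarrow> real"
  assume Ing: "FDelta S \<in> Ing T" and n: "n \<ge> 1" and \<phi>: "\<phi> \<in> MForm T S"
    and \<phi>s: "\<forall>i\<in>{1..m}. \<phi>s i \<in> MForm T S \<and> p i \<in> {0..1}"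
    and D1: "derives S {} (\<phi> \<^bold>\<rightarrow> cover m (n + k) \<phi>s)" and D2: "derives S {} (cover m k \<phi>s)"
  define r where "r = max 0 (min 1 (((\<Sum>i=1..m. p i) - real k) / real n))"
  have S: "poly_functor S" using poly_functor_Ing[OF Ing poly] by simp
  interpret algebra "pts (fspace S)" "alg (fspace S)" by (rule algebra_space[OF S])
  have m\<phi>: "denote \<phi> S \<in> alg (fspace S)" by (rule denote_measurable[OF \<phi> S])
  have card: "n + k \<le> card {i\<in>{1..m}. x \<in> denote (\<phi>s i) S}" if x: "x \<in> denote \<phi> S" for x
  proof -
    have xS: "x \<in> pts (fspace S)" using x sets_into_space[OF m\<phi>] by blast
    then show ?thesis using D1 x by (intro denote_cover[OF xS]) (auto simp: entails_def)
  qed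
  have le_r: "g (denote \<phi> S) \<le> r"
    if g: "g \<in> upper_probs (fspace S)" and le: "\<forall>i\<in>{1..m}. g (denote (\<phi>s i) S) \<le> p i" for g
  proof -
    have "real k + real n * g (denote \<phi> S) \<le> (\<Sum>i=1..m. g (denote (\<phi>s i) S))"
      using \<phi>s S by (intro upper_probs_cover_le[OF uncertainty_space_space[OF S] g _ _ m\<phi>]
          derives_cover[OF D2] card) (auto intro: denote_measurable)
    also have "\<dots> \<le> (\<Sum>i=1..m. p i)" using le by (intro sum_mono) auto
    finally have "g (denote \<phi> S) \<le> ((\<Sum>i=1..m. p i) - real k) / real n"
      using n by (simp add: field_simps)
    \<comment> \<open>Truncation preserves the bound: the minimum with 1 is harmless as
      \<open>g\<close> \<le> 1, and the maximum with 0 only enlarges the right side.\<close>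
    then show ?thesis using upper_probs_bounds[OF g m\<phi>] by (simp add: r_def)
  qed
  have "x \<in> denote (Conj (map (\<lambda>i. U_le (p i) (\<phi>s i)) [1..<Suc m]) \<^bold>\<rightarrow> U_le r \<phi>) (FDelta S)"
    if x: "x \<in> pts (fspace (FDelta S))" for x
  proof -
    obtain g where g: "x = encode (fspace S) g" "g \<in> upper_probs (fspace S)"
      using x unfolding pts_space by blast
    have "encode (fspace S) g \<in> denote (Conj (map (\<lambda>i. U_le (p i) (\<phi>s i)) [1..<Suc m])) (FDelta S)
        \<longleftrightarrow> (\<forall>i\<in>{1..m}. g (denote (\<phi>s i) S) \<le> p i)"
      using \<phi>s by (intro denote_Conj_U_le[OF S _ g(2)]) blast
    then show ?thesis
      unfolding denote_Imp[OF x] unfolding g(1) denote_bounds(3)[OF S \<phi> g(2)]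
      using le_r[OF g(2)] by blast
  qed
  \<comment> \<open>The truncated value lies in the unit interval, as the sort of
    \<open>U_le r \<phi>\<close> demands.\<close>
  moreover have "r \<in> {0..1}" by (simp add: r_def)
  ultimately show "derives (FDelta S) {}
      (Conj (map (\<lambda>i. U_le (p i) (\<phi>s i)) [1..<Suc m]) \<^bold>\<rightarrow>
       U_le (max 0 (min 1 (((\<Sum>i=1..m. p i) - real k) / real n))) \<phi>)"
    using \<phi> \<phi>s unfolding r_def[symmetric] entails_def
    by (auto simp: Form_iff has_sort_bounds simp del: functor_space.simps sem.simps upt_Suc)
qed

lemma sound_cover2: "rule_cover2 T derives"
  unfolding rule_cover2_def
proof (intro allI impI)
  fix S m k \<phi>s and p :: "nat \<Rightarrow> real"
  assume Ing: "FDelta S \<in> Ing T" and \<phi>s: "\<forall>i\<in>{1..m}. \<phi>s i \<in> MForm T S \<and> p i \<in> {0..1}"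
    and D: "derives S {} (cover m k \<phi>s)" and p: "(\<Sum>i=1..m. p i) < real k"
  have S: "poly_functor S" using poly_functor_Ing[OF Ing poly] by simp
  interpret algebra "pts (fspace S)" "alg (fspace S)" by (rule algebra_space[OF S])
  have contra: "\<not> (\<forall>i\<in>{1..m}. g (denote (\<phi>s i) S) \<le> p i)" if g: "g \<in> upper_probs (fspace S)" for g
  proof
    assume le: "\<forall>i\<in>{1..m}. g (denote (\<phi>s i) S) \<le> p i"
    \<comment> \<open>The covering inequality with \<open>n = 0\<close> and \<open>V = {}\<close>
      bounds \<open>k\<close> by the sum of the values of \<open>g\<close>, against the premise on
      the \<open>p i\<close>.\<close>
    have "real k + real 0 * g {} \<le> (\<Sum>i=1..m. g (denote (\<phi>s i) S))"
      using \<phi>s S by (intro upper_probs_cover_le[OF uncertainty_space_space[OF S] g]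
          derives_cover[OF D]) (auto intro: denote_measurable)
    also have "\<dots> \<le> (\<Sum>i=1..m. p i)" using le by (intro sum_mono) auto
    finally show False using p by simp
  qed
  have "x \<in> denote (\<^bold>\<not> Conj (map (\<lambda>i. U_le (p i) (\<phi>s i)) [1..<Suc m])) (FDelta S)"
    if x: "x \<in> pts (fspace (FDelta S))" for x
  proof -
    obtain g where g: "x = encode (fspace S) g" "g \<in> upper_probs (fspace S)"
      using x unfolding pts_space by blast
    have "encode (fspace S) g \<in> denote (Conj (map (\<lambda>i. U_le (p i) (\<phi>s i)) [1..<Suc m])) (FDelta S)
        \<longleftrightarrow> (\<forall>i\<in>{1..m}. g (denote (\<phi>s i) S) \<le> p i)"
      using \<phi>s by (intro denote_Conj_U_le[OF S _ g(2)]) blast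
    then show ?thesis
      unfolding denote_connectives(1)[OF x] unfolding g(1) using contra[OF g(2)] by blast
  qed
  then show "derives (FDelta S) {} (\<^bold>\<not> Conj (map (\<lambda>i. U_le (p i) (\<phi>s i)) [1..<Suc m]))"
    using \<phi>s unfolding entails_def
    by (auto simp: Form_iff has_sort_bounds simp del: functor_space.simps sem.simps upt_Suc)
qed

end

theorem theorem3p18:
  fixes T :: "'m func" and X :: "'x uspace" and \<alpha> :: "'x \<Rightarrow> ('x, 'm) pt"
  assumes "poly_functor T" and "coalgebra T X \<alpha>"
  shows "rule_assumption T (entails T X \<alpha>) \<and>
         rule_modus_ponens T (entails T X \<alpha>) \<and>
         rule_cut T (entails T X \<alpha>) \<and>
         rule_deduction T (entails T X \<alpha>) \<and>
         rule_necessitation T (entails T X \<alpha>) \<and>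
         rule_constant T (entails T X \<alpha>) \<and>
         rule_definite_box T (entails T X \<alpha>) \<and>
         rule_archimedean T (entails T X \<alpha>) \<and>
         rule_cover1 T (entails T X \<alpha>) \<and>
         rule_cover2 T (entails T X \<alpha>)"
proof -
  interpret poly_coalgebra T X \<alpha> using assms by unfold_locales
  show ?thesis
    by (intro conjI sound_assumption sound_modus_ponens sound_cut sound_deduction
        sound_necessitation sound_constant sound_definite_box sound_archimedean
        sound_cover1 sound_cover2)
qed

end
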